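(* Let $a$ be any integer and let $n$ be a positive odd integer. Then, for indeterminates $x$ and $q$ (equivalently, for all complex $x$ and all nonzero complex $q$), $$\det\left[x+q^{\lfloor \frac{aj-(a+1)k}{n}\rfloor}\right]_{1\leqslant j,k\leqslant n}=\left(\frac{a(a+1)}{n}\right)q^{(1-3n)/2}(1-q)^{n-1}(1+qx)$$ and $$\det\left[x+q^{\lceil \frac{(a+1)j-ak}{n}\rceil}\right]_{1\leqslant j,k\leqslant n}=\left(\frac{a(a+1)}{n}\right)q^{(n-1)/2}(1-q)^{n-1}(x+q).$$
   Context: $\lfloor x\rfloor$ is the largest integer not exceeding $x$ and $\lceil x\rceil$ is the least integer not smaller than $x$. $\left(\frac{\cdot}{n}\right)$ denotes the Jacobi symbol modulo the positive odd integer $n$ (equal to $0$ when the argument is not coprime to $n$, and $\left(\frac{\cdot}{1}\right)=1$). *)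

theory Defs
  imports "HOL-Number_Theory.Number_Theory" "Jordan_Normal_Form.Determinant"
begin

definition Jacobi :: "int \<Rightarrow> nat \<Rightarrow> int" where
  "Jacobi a n = (\<Prod>p\<in>prime_factors n. Legendre a (int p) ^ multiplicity p n)"

end

theory Submission
  imports Defs
begin

text \<open>
  Write \<open>aj = n A\<^sub>j + r\<^sub>j\<close> and \<open>(a+1)k = n B\<^sub>k + s\<^sub>k\<close> with \<open>0 \<le> r\<^sub>j, s\<^sub>k < n\<close>. The exponent is
  \<open>A\<^sub>j - B\<^sub>k\<close>, decreased by 1 if \<open>r\<^sub>j < s\<^sub>k\<close>. If \<open>a(a+1)\<close> is prime to \<open>n\<close>, then \<open>r\<close> and \<open>s\<close> permute
  the residues, so up to powers of \<open>q\<close> and the signs of these permutations the determinant is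
  that of the step matrix \<open>T\<close> (entries 1 on and below the diagonal, \<open>1/q\<close> above) plus a rank one
  matrix \<open>x u v\<^sup>T\<close>. A cyclic difference operator \<open>C\<close> satisfies \<open>C T = (1 - 1/q) I\<close>, and
  \<open>v\<^sup>T C u = q - 1\<close>: its terms correspond to pairs \<open>(j, k)\<close> with \<open>(a+1)k - aj\<close> congruent to 0
  (sign +) or to 1 (sign -) modulo \<open>n\<close>, and the shift \<open>(j, k) \<mapsto> (j+1, k+1)\<close> cancels all of them
  except \<open>(n, n)\<close> and \<open>(1, 1)\<close>. The signs multiply to the sign of multiplication by
  \<open>a(a+1)\<close> on the residues modulo \<open>n\<close>, which is the Jacobi symbol (Zolotarev).
  If \<open>a\<close> or \<open>a+1\<close> has a common factor with \<open>n\<close>, this factor is at least 3, and three rows or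
  columns lie in the span of two vectors.
  The second determinant is the transpose of the first one with \<open>1/q\<close> in place of \<open>q\<close>.
\<close>

section \<open>Signs of permutations\<close>

text \<open>A generalization of \<open>sgn (y - x)\<close>: each pair of distinct elements gets an
  orientation, which need not be transitive. Values on the diagonal are left free.\<close>

definition alternating_on :: "'a set \<Rightarrow> ('a \<Rightarrow> 'a \<Rightarrow> int) \<Rightarrow> bool" where
  "alternating_on S f \<longleftrightarrow>
     (\<forall>x\<in>S. \<forall>y\<in>S. x \<noteq> y \<longrightarrow> f x y \<in> {1, -1} \<and> f y x = - f x y)"

lemma alternating_onD:
  assumes "alternating_on S f" "x \<in> S" "y \<in> S" "x \<noteq> y"
  shows "f x y \<in> {1, -1}" "f y x = - f x y"
  using assms(1)[unfolded alternating_on_def, rule_format, OF assms(2-4)]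
  by (rule conjunct1, rule conjunct2)

definition ordered_pairs :: "nat \<Rightarrow> (nat \<times> nat) set" where
  "ordered_pairs n = {(i, j). i < j \<and> j < n}"

definition pair_prod :: "nat \<Rightarrow> (nat \<Rightarrow> nat \<Rightarrow> 'a) \<Rightarrow> 'a::comm_monoid_mult" where
  "pair_prod n f = (\<Prod>(i, j)\<in>ordered_pairs n. f i j)"

lemma finite_ordered_pairs [simp]: "finite (ordered_pairs n)"
  by (rule finite_subset[of _ "{..<n} \<times> {..<n}"]) (auto simp: ordered_pairs_def)

lemma pair_prod_mult: "pair_prod n (\<lambda>i j. f i j * g i j) = pair_prod n f * pair_prod n g"
  by (simp add: pair_prod_def prod.distrib case_prod_unfold)

lemma pair_prod_cong:
  assumes "\<And>i j. i < j \<Longrightarrow> j < n \<Longrightarrow> f i j = g i j"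
  shows "pair_prod n f = pair_prod n g"
  using assms by (auto simp: pair_prod_def ordered_pairs_def intro!: prod.cong)

text \<open>A symmetric \<open>h\<close> depends only on the unordered pair, and \<open>p\<close>
  permutes the unordered pairs. The map \<open>\<phi> p\<close> is this action, written on the
  representatives with the smaller entry first.\<close>

lemma pair_prod_permute_symmetric:
  assumes p: "p permutes {0..<n}" and sym: "\<And>x y. h x y = h y x"
  shows "pair_prod n (\<lambda>i j. h (p i) (p j)) = pair_prod n h"
proof -
  define \<phi> where "\<phi> p = (\<lambda>(i, j). (min (p i) (p j), max (p i) (p j)))" for p :: "nat \<Rightarrow> nat"
  have maps: "\<phi> r ` ordered_pairs n \<subseteq> ordered_pairs n" if r: "r permutes {0..<n}" for r
  proof (rule image_subsetI)
    fix x assume "x \<in> ordered_pairs n"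
    then obtain i j where x: "x = (i, j)" and ij: "i < j" "j < n"
      by (auto simp: ordered_pairs_def)
    hence "r i < n" "r j < n" "r i \<noteq> r j"
      using permutes_in_image[OF r, of i] permutes_in_image[OF r, of j] permutes_inj[OF r]
      by (auto simp: inj_eq)
    thus "\<phi> r x \<in> ordered_pairs n"
      by (auto simp: x \<phi>_def ordered_pairs_def min_def max_def)
  qed
  have inv: "\<phi> (inv_into UNIV p) (\<phi> p x) = x" "\<phi> p (\<phi> (inv_into UNIV p) x) = x"
    if "x \<in> ordered_pairs n" for x
    using that permutes_inverses[OF p]
    by (auto simp: \<phi>_def ordered_pairs_def min_def max_def)
  have "bij_betw (\<phi> p) (ordered_pairs n) (ordered_pairs n)"
    by (rule bij_betw_byWitness[where f' = "\<phi> (inv_into UNIV p)"])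
       (use inv maps[OF p] maps[OF permutes_inv[OF p]] in auto)
  hence "(\<Prod>x\<in>ordered_pairs n. case_prod h (\<phi> p x)) = (\<Prod>x\<in>ordered_pairs n. case_prod h x)"
    by (rule prod.reindex_bij_betw)
  moreover have "case_prod h (\<phi> p x) = (case x of (i, j) \<Rightarrow> h (p i) (p j))" for x
    using sym by (auto simp: \<phi>_def min_def max_def split: prod.splits)
  ultimately show ?thesis by (simp add: pair_prod_def)
qed

lemma pair_prod_transpose:
  assumes f: "alternating_on {0..<n} f" and bc: "b < n" "c < n" "b \<noteq> c"
  shows "pair_prod n (\<lambda>i j. f (transpose b c i) (transpose b c j)) = - pair_prod n f"
proof -
  let ?t = "transpose b c"
  have t: "?t permutes {0..<n}" using bc by (intro permutes_swap_id) auto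
  have tn: "?t i < n" if "i < n" for i
    using that permutes_in_image[OF t, of i] by auto
  \<comment> \<open>The sign of an order in which \<open>b\<close> and \<open>c\<close> are adjacent: the transposition flips it only
    on the pair \<open>{b, c}\<close>, and \<open>f\<close> differs from it by a symmetric factor.\<close>
  define \<rho> where "\<rho> x = (if x = b then -1 else if x = c then -2 else int x)" for x
  define g where "g x y = sgn (\<rho> x - \<rho> y)" for x y
  have gsq: "g i j * g i j = 1" if "i \<noteq> j" for i j
  proof -
    have "\<rho> i \<noteq> \<rho> j" using that by (simp add: \<rho>_def)
    thus ?thesis by (simp add: g_def sgn_if)
  qed
  have gt: "g (?t i) (?t j) * g i j = (if (i, j) = (min b c, max b c) then -1 else 1)"
    if "i < j" for i j
  proof -
    consider "i = b" "j = c" | "i = c" "j = b" | "i = b" "j \<noteq> c" | "i = c" "j \<noteq> b"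
      | "j = b" "i \<noteq> c" | "j = c" "i \<noteq> b" | "i \<noteq> b" "i \<noteq> c" "j \<noteq> b" "j \<noteq> c" by blast
    thus ?thesis
      using that bc by cases (simp_all add: g_def \<rho>_def transpose_def)
  qed
  have gP: "pair_prod n (\<lambda>i j. g (?t i) (?t j)) * pair_prod n g = -1"
  proof -
    have "pair_prod n (\<lambda>i j. g (?t i) (?t j) * g i j)
        = (\<Prod>x\<in>ordered_pairs n. if x = (min b c, max b c) then -1 else 1)"
      unfolding pair_prod_def by (rule prod.cong[OF refl]) (clarsimp simp only: gt ordered_pairs_def split: prod.split)
    also have "\<dots> = -1"
      using bc by (subst prod.delta) (simp_all, auto simp: ordered_pairs_def min_def max_def)
    finally show ?thesis by (simp add: pair_prod_mult)
  qed
  have gg: "pair_prod n g * pair_prod n g = 1"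
    unfolding pair_prod_mult[symmetric]
    by (auto simp: pair_prod_def ordered_pairs_def gsq intro!: prod.neutral)
  \<comment> \<open>\<open>f\<close> is alternating only below \<open>n\<close>, while
    \<open>pair_prod_permute_symmetric\<close> asks for symmetry everywhere; hence the default value
    1.\<close>
  define h where "h x y = (if x < n \<and> y < n then f x y * g x y else 1)" for x y
  have hsym: "h x y = h y x" for x y
  proof (cases "x < n \<and> y < n \<and> x \<noteq> y")
    case True
    hence "f y x = - f x y" by (intro alternating_onD(2)[OF f]) simp_all
    moreover have "g y x = - g x y" by (simp add: g_def sgn_if)
    ultimately show ?thesis using True by (simp add: h_def)
  next
    case False
    hence "x = y \<or> \<not> (x < n \<and> y < n)" by blast
    thus ?thesis by (elim disjE) (simp_all only: h_def if_False conj_commute)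
  qed
  have "pair_prod n (\<lambda>i j. h (?t i) (?t j)) = pair_prod n h"
    by (rule pair_prod_permute_symmetric[of _ _ h, OF t]) (rule hsym)
  moreover have "pair_prod n (\<lambda>i j. h (?t i) (?t j))
      = pair_prod n (\<lambda>i j. f (?t i) (?t j)) * pair_prod n (\<lambda>i j. g (?t i) (?t j))"
    unfolding pair_prod_mult[symmetric] by (rule pair_prod_cong) (simp add: h_def tn)
  moreover have "pair_prod n h = pair_prod n f * pair_prod n g"
    unfolding pair_prod_mult[symmetric] by (rule pair_prod_cong) (simp add: h_def)
  ultimately have "pair_prod n (\<lambda>i j. f (?t i) (?t j)) * pair_prod n (\<lambda>i j. g (?t i) (?t j))
      = pair_prod n f * pair_prod n g" by simp
  hence "pair_prod n (\<lambda>i j. f (?t i) (?t j))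
        * (pair_prod n (\<lambda>i j. g (?t i) (?t j)) * pair_prod n g)
      = pair_prod n f * (pair_prod n g * pair_prod n g)"
    by (simp only: mult.assoc[symmetric])
  thus ?thesis by (simp add: gP gg)
qed

text \<open>The sign of a permutation may be computed from any alternating function in place of
  the order relation; this freedom makes the sign of multiplication multiplicative in the modulus.\<close>

lemma pair_prod_permute:
  assumes p: "p permutes {0..<n}" and f: "alternating_on {0..<n} f"
  shows "pair_prod n (\<lambda>i j. f (p i) (p j)) = sign p * pair_prod n f"
  using p finite_atLeastLessThan[of 0 n] f
proof (induction p arbitrary: f rule: permutes_induct)
  case id
  show ?case by (simp add: id_def)
next
  case (swap b c p)
  let ?t = "transpose b c"
  have t: "?t permutes {0..<n}" using swap.hyps by (intro permutes_swap_id) auto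
  \<comment> \<open>The induction hypothesis for \<open>p\<close> is applied to \<open>f\<close>
    precomposed with the transposition, which is why \<open>f\<close> is kept arbitrary.\<close>
  have "alternating_on {0..<n} (\<lambda>x y. f (?t x) (?t y))"
    unfolding alternating_on_def
  proof (intro ballI impI)
    fix x y assume "x \<in> {0..<n}" "y \<in> {0..<n}" "x \<noteq> y"
    hence "?t x \<in> {0..<n}" "?t y \<in> {0..<n}" "?t x \<noteq> ?t y"
      by (simp_all only: permutes_in_image[OF t] inj_eq[OF permutes_inj[OF t]] not_False_eq_True)
    thus "f (?t x) (?t y) \<in> {1, -1} \<and> f (?t y) (?t x) = - f (?t x) (?t y)"
      by (intro conjI alternating_onD[OF swap.prems])
  qed
  note swap.IH[OF this]
  also have "pair_prod n (\<lambda>i j. f (?t i) (?t j)) = - pair_prod n f"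
    using swap.hyps by (intro pair_prod_transpose[OF swap.prems]) auto
  finally have "pair_prod n (\<lambda>i j. f (?t (p i)) (?t (p j))) = - sign p * pair_prod n f" by simp
  moreover have "sign (?t \<circ> p) = - sign p"
    using swap.hyps permutes_imp_permutation[OF _ swap.hyps(4)]
    by (subst sign_compose) (auto simp: sign_swap_id permutation_swap_id)
  ultimately show ?case by (simp only: o_def)
qed

section \<open>Zolotarev's lemma for the Jacobi symbol\<close>

text \<open>Encodes a half-system modulo \<open>n\<close>: of the classes of \<open>t\<close> and
  \<open>-t\<close> exactly one gets the value 1. Then \<open>g (y - x)\<close> is alternating on
  the residues. The value on multiples of \<open>n\<close> is free.\<close>

definition odd_sign :: "nat \<Rightarrow> (int \<Rightarrow> int) \<Rightarrow> bool" where
  "odd_sign n g \<longleftrightarrow> (\<forall>t. g (t mod int n) = g t) \<and>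
     (\<forall>t. \<not> int n dvd t \<longrightarrow> g t \<in> {1, -1} \<and> g (- t) = - g t)"

lemma odd_sign_mod: "odd_sign n g \<Longrightarrow> g (t mod int n) = g t"
  and odd_sign_values: "odd_sign n g \<Longrightarrow> \<not> int n dvd t \<Longrightarrow> g t \<in> {1, -1}"
  and odd_sign_minus: "odd_sign n g \<Longrightarrow> \<not> int n dvd t \<Longrightarrow> g (- t) = - g t"
  by (simp_all add: odd_sign_def)

lemma odd_sign_cong: "odd_sign n g \<Longrightarrow> [s = t] (mod int n) \<Longrightarrow> g s = g t"
  by (metis cong_def odd_sign_mod)

definition mult_perm :: "int \<Rightarrow> nat \<Rightarrow> nat \<Rightarrow> nat" where
  "mult_perm a n i = (if i < n then nat (a * int i mod int n) else i)"

lemma int_mult_perm: "i < n \<Longrightarrow> int (mult_perm a n i) = a * int i mod int n"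
  by (simp add: mult_perm_def)

lemma mult_perm_less: "i < n \<Longrightarrow> mult_perm a n i < n"
  by (simp add: mult_perm_def nat_less_iff)

lemma inj_on_mult_mod:
  fixes a :: int
  assumes "coprime a (int n)"
  shows "inj_on (\<lambda>i. a * int i mod int n) {0..<n}"
proof (rule inj_onI)
  fix i j assume ij: "i \<in> {0..<n}" "j \<in> {0..<n}" "a * int i mod int n = a * int j mod int n"
  hence "[int i = int j] (mod int n)"
    using assms by (simp add: cong_def[symmetric] cong_mult_lcancel)
  thus "i = j" using ij by (simp add: cong_int_iff cong_less_modulus_unique_nat)
qed

lemma mult_perm_permutes:
  assumes "coprime a (int n)"
  shows "mult_perm a n permutes {0..<n}"
proof (rule bij_imp_permutes)
  have "inj_on (mult_perm a n) {0..<n}"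
  proof (rule inj_onI)
    fix i j assume "i \<in> {0..<n}" "j \<in> {0..<n}" "mult_perm a n i = mult_perm a n j"
    thus "i = j"
      using inj_onD[OF inj_on_mult_mod[OF assms], of i j] by (metis atLeastLessThan_iff int_mult_perm)
  qed
  moreover have "mult_perm a n ` {0..<n} \<subseteq> {0..<n}"
    by (auto simp: mult_perm_less)
  ultimately show "bij_betw (mult_perm a n) {0..<n} {0..<n}"
    by (simp add: bij_betw_def endo_inj_surj)
qed (simp add: mult_perm_def)

text \<open>Group the pairs by their difference: \<open>d\<close> occurs \<open>n - d\<close>
  times.\<close>

lemma pair_prod_diff:
  "pair_prod n (\<lambda>i j. h (j - i)) = (\<Prod>d\<in>{1..<n}. h d ^ (n - d))"
proof -
  have "pair_prod n (\<lambda>i j. h (j - i)) = (\<Prod>(d, i)\<in>Sigma {1..<n} (\<lambda>d. {0..<n - d}). h d)"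
    unfolding pair_prod_def
    by (rule prod.reindex_bij_witness[where i = "\<lambda>(d, i). (i, i + d)" and j = "\<lambda>(i, j). (j - i, i)"])
       (auto simp: ordered_pairs_def)
  also have "\<dots> = (\<Prod>d\<in>{1..<n}. \<Prod>i\<in>{0..<n - d}. h d)"
    by (subst prod.Sigma) auto
  finally show ?thesis by simp
qed

text \<open>The factors for \<open>d\<close> and \<open>n - d\<close> have equal values and
  exponents adding up to the odd number \<open>n\<close>, and an odd power of a sign is the sign
  itself.\<close>

lemma prod_power_symmetric:
  fixes h :: "nat \<Rightarrow> int"
  assumes n: "odd n" and h: "\<And>d. d \<in> {1..<n} \<Longrightarrow> h d \<in> {1, -1}"
    and sym: "\<And>d. d \<in> {1..<n} \<Longrightarrow> h (n - d) = h d"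
  shows "(\<Prod>d\<in>{1..<n}. h d ^ (n - d)) = (\<Prod>d = 1..(n - 1) div 2. h d)"
proof -
  obtain M where M: "n = 2 * M + 1" using n by (auto elim: oddE)
  have "{1..<n} = {1..M} \<union> {M+1..<n}" using M by auto
  hence "(\<Prod>d\<in>{1..<n}. h d ^ (n - d))
      = (\<Prod>d\<in>{1..M}. h d ^ (n - d)) * (\<Prod>d\<in>{M+1..<n}. h d ^ (n - d))"
    by (simp only:) (subst prod.union_disjoint, auto)
  also have "(\<Prod>d\<in>{M+1..<n}. h d ^ (n - d)) = (\<Prod>d\<in>{1..M}. h d ^ d)"
    by (rule prod.reindex_bij_witness[where i = "\<lambda>d. n - d" and j = "\<lambda>d. n - d"])
       (use sym in \<open>auto simp: M\<close>)
  also have "(\<Prod>d\<in>{1..M}. h d ^ (n - d)) * (\<Prod>d\<in>{1..M}. h d ^ d) = (\<Prod>d\<in>{1..M}. h d ^ n)"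
    unfolding prod.distrib[symmetric] by (intro prod.cong) (auto simp: M power_add[symmetric])
  also have "\<dots> = (\<Prod>d\<in>{1..M}. h d)"
  proof (rule prod.cong)
    fix d assume "d \<in> {1..M}"
    hence "h d \<in> {1, -1}" by (intro h) (auto simp: M)
    thus "h d ^ n = h d" using n by auto
  qed simp
  finally show ?thesis by (simp add: M)
qed

text \<open>Both factors of \<open>h\<close> are odd in \<open>t\<close>, so their product is even,
  and by periodicity \<open>n - t\<close> may replace \<open>-t\<close>.\<close>

lemma odd_sign_ratio_properties:
  fixes a :: int
  assumes g: "odd_sign n g" and a: "coprime a (int n)" and t: "\<not> int n dvd t"
  defines "h \<equiv> \<lambda>t. g (a * t) * g t"
  shows "h t \<in> {1, -1}" and "h (int n - t) = h t"
proof -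
  have at: "\<not> int n dvd a * t"
    using a t by (simp add: coprime_commute coprime_dvd_mult_right_iff)
  show "h t \<in> {1, -1}"
    using odd_sign_values[OF g t] odd_sign_values[OF g at] by (auto simp: h_def)
  have "g (a * (int n - t)) = g (- (a * t))" "g (int n - t) = g (- t)"
    by (rule odd_sign_cong[OF g], simp add: cong_iff_dvd_diff algebra_simps)+
  thus "h (int n - t) = h t"
    using odd_sign_minus[OF g t] odd_sign_minus[OF g at] by (simp add: h_def)
qed

text \<open>Gauss's lemma for an arbitrary half-system: in \<open>pair_prod_permute\<close> with the
  alternating function \<open>g (y - x)\<close>, multiplication by \<open>a\<close> just scales the
  differences.\<close>

lemma sign_mult_perm:
  assumes n: "odd n" and a: "coprime a (int n)" and g: "odd_sign n g"
  shows "sign (mult_perm a n) = (\<Prod>d = 1..(n - 1) div 2. g (a * int d) * g (int d))"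
proof -
  define f where "f x y = g (int y - int x)" for x y
  have ndvd: "\<not> int n dvd int j - int i" if "i < n" "j < n" "i \<noteq> j" for i j
  proof
    assume "int n dvd int j - int i"
    hence "[j = i] (mod n)" by (simp add: cong_int_iff[symmetric] cong_iff_dvd_diff)
    thus False using that cong_less_modulus_unique_nat[of j i n] by simp
  qed
  have alt: "alternating_on {0..<n} f"
    unfolding alternating_on_def
  proof (intro ballI impI)
    fix x y assume "x \<in> {0..<n}" "y \<in> {0..<n}" "x \<noteq> y"
    hence "\<not> int n dvd int y - int x" by (intro ndvd) auto
    from odd_sign_values[OF g this] odd_sign_minus[OF g this]
    show "f x y \<in> {1, -1} \<and> f y x = - f x y" by (simp add: f_def)
  qed
  have "pair_prod n (\<lambda>i j. f (mult_perm a n i) (mult_perm a n j))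
      = pair_prod n (\<lambda>i j. g (a * int (j - i)))"
  proof (rule pair_prod_cong)
    fix i j assume ij: "i < j" "j < n"
    have "[a * int j mod int n - a * int i mod int n = a * int j - a * int i] (mod int n)"
      by (intro cong_diff) auto
    thus "f (mult_perm a n i) (mult_perm a n j) = g (a * int (j - i))"
      using ij unfolding f_def
      by (intro odd_sign_cong[OF g]) (simp add: int_mult_perm of_nat_diff right_diff_distrib)
  qed
  moreover have "pair_prod n f = pair_prod n (\<lambda>i j. g (int (j - i)))"
    by (rule pair_prod_cong) (simp add: f_def of_nat_diff)
  ultimately have eq: "pair_prod n (\<lambda>i j. g (a * int (j - i)))
      = sign (mult_perm a n) * pair_prod n (\<lambda>i j. g (int (j - i)))"
    using pair_prod_permute[OF mult_perm_permutes[OF a] alt] by simp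
  have "pair_prod n (\<lambda>i j. g (int (j - i)) * g (int (j - i))) = pair_prod n (\<lambda>i j. 1)"
  proof (rule pair_prod_cong)
    fix i j assume "i < j" "j < n"
    thus "g (int (j - i)) * g (int (j - i)) = 1"
      using odd_sign_values[OF g ndvd, of i j] by (auto simp: of_nat_diff)
  qed
  hence sq: "pair_prod n (\<lambda>i j. g (int (j - i))) * pair_prod n (\<lambda>i j. g (int (j - i))) = 1"
    by (simp only: pair_prod_mult) (simp add: pair_prod_def)
  \<comment> \<open>The product over the unscaled differences is its own inverse, so multiplying by
    it isolates the sign.\<close>
  have "sign (mult_perm a n)
      = sign (mult_perm a n) * pair_prod n (\<lambda>i j. g (int (j - i))) * pair_prod n (\<lambda>i j. g (int (j - i)))"
    by (simp add: sq mult.assoc)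
  also have "\<dots> = pair_prod n (\<lambda>i j. g (a * int (j - i)) * g (int (j - i)))"
    by (simp only: eq[symmetric] pair_prod_mult)
  also have "\<dots> = (\<Prod>d\<in>{1..<n}. (g (a * int d) * g (int d)) ^ (n - d))"
    by (rule pair_prod_diff[where h = "\<lambda>d. g (a * int d) * g (int d)"])
  also have "\<dots> = (\<Prod>d = 1..(n - 1) div 2. g (a * int d) * g (int d))"
  proof (rule prod_power_symmetric[OF n])
    fix d assume d: "d \<in> {1..<n}"
    hence "\<not> int n dvd int d" by (auto dest: nat_dvd_not_less simp: int_dvd_int_iff)
    from odd_sign_ratio_properties[OF g a this] d
    show "g (a * int d) * g (int d) \<in> {1, -1}"
      and "g (a * int (n - d)) * g (int (n - d)) = g (a * int d) * g (int d)"
      by (simp_all add: of_nat_diff)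
  qed
  finally show ?thesis .
qed

text \<open>The standard half-system of the residues 1 to (n - 1)/2; the class of 0 also gets the
  value 1.\<close>

lemma odd_sign_exists:
  assumes "odd n"
  shows "odd_sign n (\<lambda>t. if t mod int n \<le> (int n - 1) div 2 then 1 else -1)"
  unfolding odd_sign_def
proof (intro conjI allI impI)
  fix t assume t: "\<not> int n dvd t"
  have "(- t) mod int n = int n - t mod int n"
    using t by (simp add: zmod_zminus1_eq_if dvd_eq_mod_eq_0)
  moreover obtain M where "n = 2 * M + 1" using assms by (auto elim: oddE)
  ultimately show "(if (- t) mod int n \<le> (int n - 1) div 2 then 1 else - 1)
      = - (if t mod int n \<le> (int n - 1) div 2 then 1 else (- 1 :: int))"
    by auto
qed auto

text \<open>Each further window of \<open>m\<close> consecutive factors has product 1, because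
  reflection and periodicity pair its factors into squares, apart from
  \<open>k 0 = 1\<close>.\<close>

lemma prod_shift_period:
  fixes k :: "nat \<Rightarrow> int"
  assumes per: "\<And>d. k (d + m) = k d" and sym: "\<And>d. d \<le> m \<Longrightarrow> k (m - d) = k d"
    and val: "\<And>d. k d \<in> {1, -1}" and k0: "k 0 = 1" and m: "m = 2 * M + 1"
  shows "(\<Prod>d = 1..P * m + M. k d) = (\<Prod>d = 1..M. k d)"
proof (induction P)
  case (Suc P)
  have per': "k (d + P * m) = k d" for d P
  proof (induction P)
    case (Suc P)
    have "k (d + Suc P * m) = k (d + P * m + m)" by (simp add: algebra_simps)
    thus ?case using Suc by (simp add: per)
  qed simp
  have "{1..Suc P * m + M} = {1..P * m + M} \<union> {P * m + M + 1..P * m + M + m}" by auto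
  hence "(\<Prod>d = 1..Suc P * m + M. k d)
      = (\<Prod>d = 1..P * m + M. k d) * (\<Prod>d\<in>{P * m + M + 1..P * m + M + m}. k d)"
    by (simp only:) (subst prod.union_disjoint, auto)
  also have "(\<Prod>d\<in>{P * m + M + 1..P * m + M + m}. k d) = (\<Prod>d\<in>{M + 1..M + m}. k d)"
    by (rule prod.reindex_bij_witness[symmetric, where i = "\<lambda>d. d - P * m" and j = "\<lambda>d. d + P * m"])
       (auto simp: per')
  \<comment> \<open>Reflection in \<open>m\<close> sends the lower block to \<open>{1..M}\<close>,
    and a shift by \<open>m\<close> sends the upper block to \<open>{0..M}\<close>. The two blocks
    thus have the same product, a sign.\<close>
  also have "{M + 1..M + m} = {M + 1..2 * M} \<union> {m..M + m}" using m by auto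
  also have "prod k \<dots> = (\<Prod>d\<in>{M + 1..2 * M}. k d) * (\<Prod>d\<in>{m..M + m}. k d)"
    by (subst prod.union_disjoint) (auto simp: m)
  also have "(\<Prod>d\<in>{M + 1..2 * M}. k d) = (\<Prod>d\<in>{1..M}. k d)"
    by (rule prod.reindex_bij_witness[where i = "\<lambda>d. m - d" and j = "\<lambda>d. m - d"])
       (use sym in \<open>auto simp: m\<close>)
  also have "(\<Prod>d\<in>{m..M + m}. k d) = (\<Prod>d\<in>{0..M}. k d)"
    by (rule prod.reindex_bij_witness[symmetric, where i = "\<lambda>d. d - m" and j = "\<lambda>d. d + m"])
       (auto simp: per)
  also have "\<dots> = (\<Prod>d\<in>{1..M}. k d)"
    by (simp add: prod.atLeast_Suc_atMost k0)
  also have "(\<Prod>d\<in>{1..M}. k d) * (\<Prod>d\<in>{1..M}. k d) = 1"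
    unfolding prod.distrib[symmetric]
  proof (rule prod.neutral, rule ballI)
    fix d show "k d * k d = 1" using val[of d] by auto
  qed
  finally show ?case using Suc by simp
qed simp

lemma sign_mult_perm_mult:
  assumes odd: "odd p" "odd m" and a: "coprime a (int (p * m))"
  shows "sign (mult_perm a (p * m)) = sign (mult_perm a p) * sign (mult_perm a m)"
proof -
  have ap: "coprime a (int p)" and am: "coprime a (int m)" using a by simp_all
  obtain P where P: "p = 2 * P + 1" using odd by (auto elim: oddE)
  obtain M where M: "m = 2 * M + 1" using odd by (auto elim: oddE)
  obtain gp gm where gp: "odd_sign p gp" and gm: "odd_sign m gm"
    using odd_sign_exists odd by blast
  \<comment> \<open>With this choice of odd function for the modulus \<open>p m\<close>, the factors with \<open>m dvd d\<close> give the
    sign for \<open>p\<close>, and the others give the sign for \<open>m\<close>, repeated with period \<open>m\<close>.\<close>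
  define G where "G t = (if int m dvd t then gp (t div int m) else gm t)" for t
  have m0: "int m \<noteq> 0" using M by simp
  have dvdm: "int m dvd t mod int (p * m) \<longleftrightarrow> int m dvd t" for t
    by (simp add: dvd_mod_iff)
  have G: "odd_sign (p * m) G"
    unfolding odd_sign_def
  proof (intro conjI allI impI)
    fix t
    show "G (t mod int (p * m)) = G t"
    proof (cases "int m dvd t")
      case True
      then obtain s where s: "t = int m * s" by blast
      have "t mod int (p * m) = int m * (s mod int p)"
        by (simp add: s mult.commute[of "int p"])
      thus ?thesis using odd_sign_mod[OF gp, of s] m0 by (simp add: G_def s)
    next
      case False
      have "[t mod int (p * m) = t] (mod int m)"
        by (simp add: cong_def mod_mod_cancel)
      thus ?thesis using False by (simp only: G_def dvdm if_False odd_sign_cong[OF gm])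
    qed
  next
    fix t assume t: "\<not> int (p * m) dvd t"
    have "G t \<in> {1, -1} \<and> G (- t) = - G t"
    proof (cases "int m dvd t")
      case True
      then obtain s where s: "t = int m * s" by blast
      have "\<not> int p dvd s" using t by (auto simp: s)
      moreover have "- (int m * s) div int m = - s" using m0
        by (metis mult_minus_right nonzero_mult_div_cancel_left)
      ultimately show ?thesis
        using odd_sign_values[OF gp, of s] odd_sign_minus[OF gp, of s] m0 by (simp add: G_def s)
    next
      case False
      thus ?thesis
        using odd_sign_values[OF gm, of t] odd_sign_minus[OF gm, of t] by (simp add: G_def)
    qed
    thus "G t \<in> {1, -1}" "G (- t) = - G t" by blast+
  qed
  define k where "k d = (if m dvd d then 1 else gm (a * int d) * gm (int d))" for d
  define l where "l d = (if m dvd d then gp (a * int (d div m)) * gp (int (d div m)) else 1)" for d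
  have Gkl: "G (a * int d) * G (int d) = k d * l d" for d
  proof (cases "m dvd d")
    case True
    then obtain s where s: "d = m * s" by blast
    have "a * (int m * int s) div int m = a * int s"
      using m0 by (metis mult.left_commute nonzero_mult_div_cancel_left)
    thus ?thesis using m0 by (simp add: s G_def k_def l_def)
  next
    case False
    hence "\<not> int m dvd int d" by (simp add: int_dvd_int_iff)
    moreover from this have "\<not> int m dvd a * int d"
      using am by (simp add: coprime_commute coprime_dvd_mult_right_iff)
    ultimately show ?thesis using False by (simp add: G_def k_def l_def)
  qed
  \<comment> \<open>Half of the modulus \<open>p * m\<close> is \<open>P\<close> full periods of
    \<open>m\<close> and the half period \<open>M\<close>. As \<open>M < m\<close>, the multiples of
    \<open>m\<close> in this range are \<open>m * s\<close> with \<open>1 \<le> s \<le> P\<close>,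
    the half range for \<open>p\<close>.\<close>
  have half: "(p * m - 1) div 2 = P * m + M"
    by (simp add: P M algebra_simps)
  have "(\<Prod>d = 1..P * m + M. k d) = (\<Prod>d = 1..M. k d)"
  proof (rule prod_shift_period[OF _ _ _ _ M])
    fix d
    have "gm (a * int (d + m)) = gm (a * int d)" "gm (int (d + m)) = gm (int d)"
      by (rule odd_sign_cong[OF gm], simp add: cong_iff_dvd_diff algebra_simps)+
    thus "k (d + m) = k d" by (simp add: k_def)
    show "k d \<in> {1, -1}"
      using odd_sign_ratio_properties(1)[OF gm am, of "int d"]
      by (auto simp: k_def int_dvd_int_iff)
    show "k (m - d) = k d" if "d \<le> m"
    proof -
      have "m dvd m - d \<longleftrightarrow> m dvd d" using that by (metis dvd_diff_nat dvd_refl diff_diff_cancel)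
      thus ?thesis
        using odd_sign_ratio_properties(2)[OF gm am, of "int d"] that
        by (auto simp: k_def int_dvd_int_iff of_nat_diff)
    qed
  qed (simp add: k_def)
  also have "\<dots> = (\<Prod>d = 1..(m - 1) div 2. gm (a * int d) * gm (int d))"
    by (rule prod.cong) (auto simp: M k_def dest: dvd_imp_le)
  also have "\<dots> = sign (mult_perm a m)"
    by (rule sign_mult_perm[symmetric, OF odd(2) am gm])
  finally have K: "(\<Prod>d = 1..P * m + M. k d) = sign (mult_perm a m)" .
  have "(\<Prod>d = 1..P * m + M. l d) = (\<Prod>d\<in>{d \<in> {1..P * m + M}. m dvd d}. l d)"
    by (rule prod.mono_neutral_right) (auto simp: l_def)
  also have "\<dots> = (\<Prod>s = 1..P. gp (a * int s) * gp (int s))"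
  proof (rule prod.reindex_bij_witness[where i = "\<lambda>s. m * s" and j = "\<lambda>d. d div m"])
    fix d assume "d \<in> {d \<in> {1..P * m + M}. m dvd d}"
    then obtain s where s: "d = m * s" "1 \<le> m * s" "m * s \<le> P * m + M" by auto
    have "m * s < m * (P + 1)" using s(3) M by (simp add: algebra_simps)
    hence "s < P + 1" by (rule mult_less_cancel1[THEN iffD1, THEN conjunct2])
    thus "d div m \<in> {1..P}" using s m0 by auto
    show "m * (d div m) = d" using s m0 by simp
    show "gp (a * int (d div m)) * gp (int (d div m)) = l d" by (simp add: l_def s)
  next
    fix s assume s: "s \<in> {1..P}"
    show "m * s div m = s" using m0 by simp
    have "m * s \<le> m * P" using s by simp
    moreover have "1 \<le> m * s" using s m0 by auto
    ultimately show "m * s \<in> {d \<in> {1..P * m + M}. m dvd d}"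
      by (simp add: mult.commute[of P] trans_le_add1)
  qed
  also have "\<dots> = sign (mult_perm a p)"
    using sign_mult_perm[OF odd(1) ap gp] by (simp add: P)
  finally have L: "(\<Prod>d = 1..P * m + M. l d) = sign (mult_perm a p)" .
  have "sign (mult_perm a (p * m)) = (\<Prod>d = 1..P * m + M. k d * l d)"
    using odd sign_mult_perm[OF _ a G] by (simp only: half Gkl even_mult_iff simp_thms)
  thus ?thesis by (simp only: prod.distrib K L mult.commute)
qed

text \<open>With the standard half-system the sign is -1 to the number of residues
  \<open>a * d\<close> beyond (p - 1)/2, which is the Legendre symbol by Gauss's lemma.\<close>

lemma sign_mult_perm_prime:
  assumes p: "prime p" "odd p" and a: "coprime a (int p)"
  shows "sign (mult_perm a p) = Legendre a (int p)"
proof -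
  \<comment> \<open>The locale \<open>GAUSS\<close> asks for a positive multiplier, so
    \<open>a\<close> is replaced by its residue.\<close>
  define b where "b = a mod int p"
  have p2: "2 < p" using p prime_ge_2_nat[of p] by (cases "p = 2") auto
  have "\<not> int p dvd a"
  proof
    assume "int p dvd a"
    hence "is_unit (int p)" using a by (auto dest: coprime_common_divisor)
    thus False using p2 by simp
  qed
  hence b0: "b \<noteq> 0" "0 \<le> b" using p2 by (auto simp: b_def dvd_eq_mod_eq_0)
  interpret GAUSS p b
    using p(1) p2 b0 by unfold_locales (simp_all add: cong_def b_def order_less_le)
  let ?M = "(int p - 1) div 2"
  let ?S = "{d \<in> {1..(p - 1) div 2}. \<not> a * int d mod int p \<le> ?M}"
  have half: "int ((p - 1) div 2) = ?M" using p2 by (simp add: of_nat_diff zdiv_int)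
  have "sign (mult_perm a p)
      = (\<Prod>d = 1..(p - 1) div 2. (if a * int d mod int p \<le> ?M then 1 else -1)
          * (if int d mod int p \<le> ?M then 1 else -1))"
    by (rule sign_mult_perm[OF p(2) a odd_sign_exists[OF p(2)]])
  also have "\<dots> = (\<Prod>d = 1..(p - 1) div 2. if a * int d mod int p \<le> ?M then 1 else -1)"
  proof (rule prod.cong)
    fix d assume d: "d \<in> {1..(p - 1) div 2}"
    hence "d < p" "int d \<le> ?M" using half by auto
    thus "(if a * int d mod int p \<le> ?M then 1 else -1)
        * (if int d mod int p \<le> ?M then 1 else -1)
        = (if a * int d mod int p \<le> ?M then 1 else (-1 :: int))" by simp
  qed simp
  also have "\<dots> = (\<Prod>d\<in>?S. -1)"
    by (rule prod.mono_neutral_cong_right) auto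
  also have "\<dots> = (-1) ^ card ?S" by simp
  also have "card ?S = card E"
  proof (rule bij_betw_same_card[of "\<lambda>d. a * int d mod int p"])
    have A: "A = int ` {1..(p - 1) div 2}"
    proof
      show "A \<subseteq> int ` {1..(p - 1) div 2}"
      proof
        fix x assume "x \<in> A"
        hence "x = int (nat x)" "nat x \<in> {1..(p - 1) div 2}"
          using half by (auto simp: A_def)
        thus "x \<in> int ` {1..(p - 1) div 2}" by blast
      qed
      show "int ` {1..(p - 1) div 2} \<subseteq> A" unfolding A_def half[symmetric] by auto
    qed
    have "C = (\<lambda>d. a * int d mod int p) ` {1..(p - 1) div 2}"
      unfolding C_def B_def A image_image
      by (intro image_cong) (simp_all add: b_def mod_mult_right_eq mult.commute)
    hence "E = (\<lambda>d. a * int d mod int p) ` ?S"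
      unfolding E_def by auto
    moreover have "inj_on (\<lambda>d. a * int d mod int p) ?S"
      using p2 by (intro inj_on_subset[OF inj_on_mult_mod[OF a]]) auto
    ultimately show "bij_betw (\<lambda>d. a * int d mod int p) ?S E"
      by (simp add: bij_betw_def)
  qed
  also have "(-1) ^ card E = Legendre b (int p)" by (rule gauss_lemma[symmetric])
  also have "\<dots> = Legendre a (int p)"
    by (simp add: Legendre_def QuadRes_def b_def cong_def)
  finally show ?thesis .
qed

section \<open>The Jacobi symbol prime by prime\<close>

lemma Jacobi_eq_prod_mset:
  "Jacobi a n = (\<Prod>p\<in>#prime_factorization n. Legendre a (int p))"
  unfolding Jacobi_def image_prod_mset_multiplicity
  by (rule prod.cong) (auto simp: count_prime_factorization_prime in_prime_factors_imp_prime)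

lemma Jacobi_prime_mult:
  assumes "prime p" "m > 0"
  shows "Jacobi a (p * m) = Legendre a (int p) * Jacobi a m"
  using assms by (simp add: Jacobi_eq_prod_mset prime_factorization_times_prime)

text \<open>Both sides are multiplicative when one prime is split off; oddness of \<open>n\<close>
  excludes the prime 2 and \<open>n = 0\<close>.\<close>

lemma sign_mult_perm_eq_Jacobi:
  assumes "odd n" "coprime a (int n)"
  shows "sign (mult_perm a n) = Jacobi a n"
  using assms
proof (induction n rule: prime_divisors_induct)
  case (unit n)
  hence "n = 1" by simp
  thus ?case
    using sign_mult_perm[OF _ _ odd_sign_exists, of 1 a] by (simp add: Jacobi_def)
next
  case (factor p m)
  hence "odd p" "odd m" "m > 0" "coprime a (int p)" "coprime a (int m)"
    by (auto intro: Nat.gr0I)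
  with factor show ?case
    by (simp add: sign_mult_perm_mult sign_mult_perm_prime Jacobi_prime_mult)
qed simp

text \<open>A common prime divisor contributes a vanishing Legendre symbol.\<close>

lemma Jacobi_eq_0:
  assumes "n > 0" "\<not> coprime a (int n)"
  shows "Jacobi a n = 0"
proof -
  have "nat (gcd a (int n)) \<noteq> 1" using assms(2) by (simp add: coprime_iff_gcd_eq_1)
  then obtain p where p: "prime p" "p dvd nat (gcd a (int n))"
    using prime_factor_nat by blast
  have "int p dvd int (nat (gcd a (int n)))" using p(2) by (simp only: int_dvd_int_iff)
  hence "int p dvd a" "p dvd n" by (simp_all add: int_dvd_int_iff)
  hence "p \<in># prime_factorization n" "Legendre a (int p) = 0"
    using p(1) assms(1) by (auto simp: in_prime_factors_iff Legendre_def cong_0_iff)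
  thus ?thesis unfolding Jacobi_eq_prod_mset by (auto simp: prod_mset_zero_iff image_iff)
qed

section \<open>Determinants\<close>

text \<open>The matrix determinant lemma, proved without division: multiplying the block matrix
  \<open>?K\<close> by the unipotent \<open>?E\<close> on the left and on the right makes it block
  triangular in two ways, and both products have determinant \<open>det ?K\<close>.\<close>

lemma det_one_plus_rank_one:
  fixes w v :: "nat \<Rightarrow> 'a::idom"
  shows "det (mat n n (\<lambda>(i, j). (if i = j then 1 else 0) + w i * v j)) = 1 + (\<Sum>i<n. w i * v i)"
proof -
  let ?W = "mat n 1 (\<lambda>(i, _). w i)" and ?V = "mat 1 n (\<lambda>(_, j). v j)"
  let ?K = "four_block_mat (1\<^sub>m n) ?W (- ?V) (1\<^sub>m 1)"
  let ?E = "four_block_mat (1\<^sub>m n) (0\<^sub>m n 1) ?V (1\<^sub>m 1)"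
  let ?A = "mat n n (\<lambda>(i, j). (if i = j then 1 else 0) + w i * v j)"
  let ?s = "mat 1 1 (\<lambda>_. 1 + (\<Sum>i<n. w i * v i))"
  have K: "?K \<in> carrier_mat (n + 1) (n + 1)" and E: "?E \<in> carrier_mat (n + 1) (n + 1)"
    by (auto intro!: four_block_carrier_mat)
  have detE: "det ?E = 1"
    by (subst det_four_block_mat_upper_right_zero[where n = n and m = 1]) auto
  have "?E * ?K = four_block_mat (1\<^sub>m n) ?W (0\<^sub>m 1 n) ?s"
    by (subst mult_four_block_mat[where ?nr1.0 = n and ?n1.0 = n and ?n2.0 = 1
          and ?nr2.0 = 1 and ?nc1.0 = n and ?nc2.0 = 1])
       (auto intro!: arg_cong2[where f = "four_block_mat _"] eq_matI
          simp: scalar_prod_def mult.commute lessThan_atLeast0 add.commute)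
  hence "det (?E * ?K) = 1 + (\<Sum>i<n. w i * v i)"
    by (simp add: det_four_block_mat_lower_left_zero[where n = n and m = 1] det_single)
  hence 1: "det ?K = 1 + (\<Sum>i<n. w i * v i)"
    using det_mult[OF E K] detE by simp
  have "?K * ?E = four_block_mat ?A ?W (0\<^sub>m 1 n) (1\<^sub>m 1)"
    by (subst mult_four_block_mat[where ?nr1.0 = n and ?n1.0 = n and ?n2.0 = 1
          and ?nr2.0 = 1 and ?nc1.0 = n and ?nc2.0 = 1])
       (auto intro!: cong_four_block_mat eq_matI simp: scalar_prod_def)
  hence "det (?K * ?E) = det ?A"
    by (simp add: det_four_block_mat_lower_left_zero[where n = n and m = 1])
  thus ?thesis using det_mult[OF K E] detE 1 by simp
qed

text \<open>Every Leibniz term takes exactly one entry from each row and each column.\<close>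

lemma det_scale_rows_cols:
  fixes B :: "nat \<Rightarrow> nat \<Rightarrow> 'a::comm_ring_1"
  shows "det (mat n n (\<lambda>(i, j). \<alpha> i * \<beta> j * B i j))
       = (\<Prod>i<n. \<alpha> i) * (\<Prod>j<n. \<beta> j) * det (mat n n (\<lambda>(i, j). B i j))"
proof -
  have "(\<Prod>i = 0..<n. \<alpha> i * \<beta> (p i) * B i (p i))
      = (\<Prod>i<n. \<alpha> i) * (\<Prod>j<n. \<beta> j) * (\<Prod>i = 0..<n. B i (p i))"
    if p: "p permutes {0..<n}" for p
    using prod.permute[OF p, of \<beta>] by (simp add: prod.distrib lessThan_atLeast0 o_def)
  thus ?thesis
    by (auto simp: det_def' [where n = n] sum_distrib_left permutes_in_image intro!: sum.cong)
qed

lemma det_permute_rows_cols: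
  fixes B :: "nat \<Rightarrow> nat \<Rightarrow> 'a::comm_ring_1"
  assumes p: "p permutes {0..<n}" and r: "r permutes {0..<n}"
  shows "det (mat n n (\<lambda>(i, j). B (p i) (r j)))
       = of_int (sign p * sign r) * det (mat n n (\<lambda>(i, j). B i j))"
proof -
  have *: "det (mat n n (\<lambda>(i, j). C (p i) j)) = of_int (sign p) * det (mat n n (\<lambda>(i, j). C i j))"
    if p: "p permutes {0..<n}" for p and C :: "nat \<Rightarrow> nat \<Rightarrow> 'a"
  proof -
    have "p i < n" if "i < n" for i using permutes_in_image[OF p, of i] that by simp
    hence "mat n n (\<lambda>(i, j). C (p i) j) = mat n n (\<lambda>(i, j). mat n n (\<lambda>(i, j). C i j) $$ (p i, j))"
      by (auto intro!: eq_matI)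
    thus ?thesis using det_permute_rows[OF _ p, of "mat n n (\<lambda>(i, j). C i j)"] by simp
  qed
  \<comment> \<open>Columns are permuted by transposing, permuting rows and transposing
    back.\<close>
  have t: "det (mat n n (\<lambda>(i, j). C j i)) = det (mat n n (\<lambda>(i, j). C i j))"
    for C :: "nat \<Rightarrow> nat \<Rightarrow> 'a"
  proof -
    have "mat n n (\<lambda>(i, j). C j i) = transpose_mat (mat n n (\<lambda>(i, j). C i j))"
      by (auto intro!: eq_matI)
    thus ?thesis using det_transpose[of "mat n n (\<lambda>(i, j). C i j)" n] by simp
  qed
  have "det (mat n n (\<lambda>(i, j). B (p i) (r j))) = of_int (sign p) * det (mat n n (\<lambda>(i, j). B i (r j)))"
    by (rule *[OF p])
  also have "det (mat n n (\<lambda>(i, j). B i (r j))) = det (mat n n (\<lambda>(j, i). B i (r j)))"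
    by (rule t)
  also have "\<dots> = of_int (sign r) * det (mat n n (\<lambda>(j, i). B i j))"
    by (rule *[OF r])
  also have "det (mat n n (\<lambda>(j, i). B i j)) = det (mat n n (\<lambda>(i, j). B i j))"
    by (rule t)
  finally show ?thesis by simp
qed

text \<open>The matrix of this operator inverts the step matrix up to the factor \<open>1 - c\<close>.\<close>

definition twisted_diff :: "nat \<Rightarrow> 'a::comm_ring_1 \<Rightarrow> (nat \<Rightarrow> 'a) \<Rightarrow> nat \<Rightarrow> 'a" where
  "twisted_diff n c u r = u r - (if r = 0 then c * u (n - 1) else u (r - 1))"

text \<open>A difference of two indicators instead of a case distinction, so that for
  \<open>n = 1\<close>, where both positions coincide, the entry is \<open>1 - c\<close>.\<close>

definition twisted_diff_mat :: "nat \<Rightarrow> 'a::comm_ring_1 \<Rightarrow> 'a mat" where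
  "twisted_diff_mat n c = mat n n (\<lambda>(r, s). (if s = r then 1 else 0)
      - (if s = (if r = 0 then n - 1 else r - 1) then (if r = 0 then c else 1) else 0))"

lemma twisted_diff_mat_mult:
  "twisted_diff_mat n c * mat n n (\<lambda>(r, s). B r s)
     = mat n n (\<lambda>(r, s). twisted_diff n c (\<lambda>r. B r s) r)"
proof (rule eq_matI)
  fix r s assume rs: "r < dim_row (mat n n (\<lambda>(r, s). twisted_diff n c (\<lambda>r. B r s) r))"
    "s < dim_col (mat n n (\<lambda>(r, s). twisted_diff n c (\<lambda>r. B r s) r))"
  let ?r = "if r = 0 then n - 1 else r - 1"
  have "(twisted_diff_mat n c * mat n n (\<lambda>(r, s). B r s)) $$ (r, s)
      = (\<Sum>i = 0..<n. ((if i = r then 1 else 0) - (if i = ?r then (if r = 0 then c else 1) else 0)) * B i s)"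
    using rs by (simp add: twisted_diff_mat_def scalar_prod_def)
  also have "\<dots> = (\<Sum>i = 0..<n. if i = r then B i s else 0)
      - (\<Sum>i = 0..<n. if i = ?r then (if r = 0 then c else 1) * B i s else 0)"
    unfolding sum_subtractf[symmetric] by (intro sum.cong) (auto simp: left_diff_distrib)
  also have "\<dots> = B r s - (if r = 0 then c else 1) * B ?r s"
    using rs by (auto simp: sum.delta)
  finally show "(twisted_diff_mat n c * mat n n (\<lambda>(r, s). B r s)) $$ (r, s)
      = mat n n (\<lambda>(r, s). twisted_diff n c (\<lambda>r. B r s) r) $$ (r, s)"
    using rs by (simp add: twisted_diff_def)
qed (simp_all add: twisted_diff_mat_def)

text \<open>Multiplied by the unitriangular all-ones matrix, the operator telescopes to the identity
  with \<open>c\<close> subtracted throughout row 0, a rank one update.\<close>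

lemma det_twisted_diff_mat:
  fixes c :: "'a::idom"
  assumes n: "n > 0"
  shows "det (twisted_diff_mat n c) = 1 - c"
proof -
  let ?L = "mat n n (\<lambda>(r, s). if s \<le> r then 1 else 0 :: 'a)"
  have "det ?L = prod_list (diag_mat ?L)"
    by (rule det_lower_triangular[where n = n]) auto
  also have "diag_mat ?L = replicate n 1"
    by (rule nth_equalityI) (auto simp: diag_mat_def)
  also have "prod_list (replicate n 1) = (1 :: 'a)" by simp
  finally have "det ?L = 1" .
  moreover have "twisted_diff_mat n c * ?L
      = mat n n (\<lambda>(i, j). (if i = j then 1 else 0) + (if i = 0 then - c else 0) * 1)"
    unfolding twisted_diff_mat_mult
    by (rule eq_matI) (auto simp: twisted_diff_def)
  moreover have "det (twisted_diff_mat n c * ?L) = det (twisted_diff_mat n c) * det ?L"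
    by (rule det_mult[where n = n]) (auto simp: twisted_diff_mat_def)
  moreover have "(\<Sum>i<n. (if i = 0 then - c else 0) * 1) = - c"
    using n by simp
  ultimately show ?thesis
    by (simp only: det_one_plus_rank_one) simp
qed

lemma det_step_matrix_plus_rank_one:
  fixes c :: "'a::field"
  assumes n: "n > 0" and c: "c \<noteq> 1"
  shows "det (mat n n (\<lambda>(r, s). (if s \<le> r then 1 else c) + u r * v s))
       = (1 - c) ^ (n - 1) * (1 + (\<Sum>r<n. twisted_diff n c u r * v r) / (1 - c))"
proof -
  let ?T = "mat n n (\<lambda>(r, s). (if s \<le> r then 1 else c) + u r * v s)"
  let ?I = "mat n n (\<lambda>(i, j). (if i = j then 1 else 0) + (twisted_diff n c u i / (1 - c)) * v j)"
  have "twisted_diff_mat n c * ?T = (1 - c) \<cdot>\<^sub>m ?I"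
    unfolding twisted_diff_mat_mult
    by (rule eq_matI) (use c in \<open>auto simp: twisted_diff_def field_simps\<close>)
  moreover have "det (twisted_diff_mat n c * ?T) = det (twisted_diff_mat n c) * det ?T"
    by (rule det_mult[where n = n]) (auto simp: twisted_diff_mat_def)
  \<comment> \<open>The operator has determinant \<open>1 - c\<close>; cancelling it lowers the
    exponent from \<open>n\<close> to \<open>n - 1\<close>.\<close>
  ultimately have "(1 - c) * det ?T = (1 - c) ^ n * det ?I"
    by (simp add: det_twisted_diff_mat[OF n])
  also have "det ?I = 1 + (\<Sum>i<n. twisted_diff n c u i / (1 - c) * v i)"
    by (rule det_one_plus_rank_one)
  also have "(1 - c) ^ n * \<dots> = (1 - c) * ((1 - c) ^ (n - 1) * \<dots>)"
    using n by (cases n) simp_all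
  finally have "det ?T = (1 - c) ^ (n - 1) * (1 + (\<Sum>i<n. twisted_diff n c u i / (1 - c) * v i))"
    using c by simp
  also have "(\<Sum>i<n. twisted_diff n c u i / (1 - c) * v i) = (\<Sum>r<n. twisted_diff n c u r * v r) / (1 - c)"
    by (simp add: sum_divide_distrib)
  finally show ?thesis .
qed

section \<open>Floors of differences and pairs of residues\<close>

lemma int_div_diff:
  fixes X Y n :: int
  assumes "n > 0"
  shows "(X - Y) div n = X div n - Y div n - (if Y mod n \<le> X mod n then 0 else 1)"
proof -
  have bounds: "0 \<le> X mod n" "X mod n < n" "0 \<le> Y mod n" "Y mod n < n"
    using assms by simp_all
  have "X = n * (X div n) + X mod n" "Y = n * (Y div n) + Y mod n" by simp_all
  \<comment> \<open>Subtraction with borrow: if the remainder of \<open>Y\<close> is the larger one,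
    one \<open>n\<close> moves from the quotient to the remainder.\<close>
  hence eq: "X - Y = n * (X div n - Y div n - (if Y mod n \<le> X mod n then 0 else 1))
      + (X mod n - Y mod n + (if Y mod n \<le> X mod n then 0 else n))"
    by (simp add: algebra_simps)
  show ?thesis
    by (rule int_div_pos_eq[OF eq]; insert bounds; split if_split; intro conjI impI; linarith)
qed

text \<open>Since \<open>e (j + 1) (k + 1) = e j k + 1\<close>, a diagonal shift matches the two
  sums. The unmatched pairs are \<open>(n - 1, n - 1)\<close> with \<open>e = n\<close> and
  \<open>(0, 0)\<close> with \<open>e = 1\<close>, as indices start at 0.\<close>

lemma sum_over_residue_classes:
  fixes a :: int and F :: "int \<Rightarrow> 'a::ab_group_add"
  assumes n: "n > 0" and a: "coprime a (int n)" and b: "coprime (a + 1) (int n)"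
  defines "e \<equiv> \<lambda>j k. (a + 1) * (int k + 1) - a * (int j + 1)"
  shows "(\<Sum>(j, k)\<in>{(j, k). j < n \<and> k < n \<and> int n dvd e j k}. F (e j k div int n))
       - (\<Sum>(j, k)\<in>{(j, k). j < n \<and> k < n \<and> int n dvd e j k - 1}. F ((e j k - 1) div int n))
       = F 1 - F 0"
proof -
  let ?S = "{(j, k). j < n \<and> k < n \<and> int n dvd e j k}"
  let ?R = "{(j, k). j < n \<and> k < n \<and> int n dvd e j k - 1}"
  have fin: "finite ?S" "finite ?R"
    by (rule finite_subset[of _ "{..<n} \<times> {..<n}"]; auto)+
  have small: "d = 0" if "c = a \<or> c = a + 1" "int n dvd c * int d" "d < n" for c :: int and d
  proof -
    have "coprime (int n) c" using that(1) a b by (auto simp: coprime_commute)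
    hence "int n dvd int d" using that(2) by (simp add: coprime_dvd_mult_right_iff)
    thus ?thesis using that(3) by (auto dest: dvd_imp_le)
  qed
  have big: "Suc d = n" if "c = a \<or> c = a + 1" "int n dvd c * (int d + 1)" "d < n" for c :: int and d
  proof -
    have "coprime (int n) c" using that(1) a b by (auto simp: coprime_commute)
    hence "int n dvd int (Suc d)"
      using that(2) by (simp add: coprime_dvd_mult_right_iff add.commute)
    hence "n dvd Suc d" by (simp only: int_dvd_int_iff)
    thus ?thesis using that(3) by (auto dest: dvd_imp_le)
  qed
  \<comment> \<open>The shift leaves the square as soon as one index is \<open>n - 1\<close>;
    coprimality makes this happen for both at once, so only the corner is lost. \<open>botR\<close>
    is the same for the inverse shift.\<close>
  have topS: "j = n - 1 \<longleftrightarrow> k = n - 1" if "(j, k) \<in> ?S" for j k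
  proof
    assume "j = n - 1"
    hence "int n dvd (a + 1) * (int k + 1) - a * int n" using that n by (simp add: e_def of_nat_diff)
    hence "int n dvd (a + 1) * (int k + 1)" by (simp add: dvd_diff_left_iff)
    thus "k = n - 1" using big[of "a + 1" k] that by auto
  next
    assume "k = n - 1"
    hence "int n dvd (a + 1) * int n - a * (int j + 1)" using that n by (simp add: e_def of_nat_diff)
    hence "int n dvd a * (int j + 1)" by (simp add: dvd_diff_right_iff)
    thus "j = n - 1" using big[of a j] that by auto
  qed
  have botR: "j = 0 \<longleftrightarrow> k = 0" if "(j, k) \<in> ?R" for j k
  proof
    assume "j = 0"
    hence "int n dvd (a + 1) * int k" using that by (simp add: e_def algebra_simps)
    thus "k = 0" using small[of "a + 1" k] that by auto
  next
    assume "k = 0"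
    hence "int n dvd - (a * int j)" using that by (simp add: e_def algebra_simps)
    thus "j = 0" using small[of a j] that by auto
  qed
  have S1: "(n - 1, n - 1) \<in> ?S" and R0: "(0, 0) \<in> ?R"
    using n by (auto simp: e_def of_nat_diff algebra_simps)
  have "(\<Sum>(j, k)\<in>?S - {(n - 1, n - 1)}. F (e j k div int n))
      = (\<Sum>(j, k)\<in>?R - {(0, 0)}. F ((e j k - 1) div int n))"
  proof (rule sum.reindex_bij_witness[where j = "\<lambda>(j, k). (Suc j, Suc k)" and i = "\<lambda>(j, k). (j - 1, k - 1)"])
    fix x assume x: "x \<in> ?S - {(n - 1, n - 1)}"
    then obtain j k where jk: "x = (j, k)" by (cases x)
    show "(case case x of (j, k) \<Rightarrow> (Suc j, Suc k) of (j, k) \<Rightarrow> (j - 1, k - 1)) = x"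
      by (simp add: jk)
    have "Suc j < n" "Suc k < n" using x jk topS[of j k] by auto
    thus "(case x of (j, k) \<Rightarrow> (Suc j, Suc k)) \<in> ?R - {(0, 0)}"
      using x jk by (auto simp: e_def algebra_simps)
    show "(case case x of (j, k) \<Rightarrow> (Suc j, Suc k) of (j, k) \<Rightarrow> F ((e j k - 1) div int n))
        = (case x of (j, k) \<Rightarrow> F (e j k div int n))"
      by (simp add: jk e_def algebra_simps)
  next
    fix x assume x: "x \<in> ?R - {(0, 0)}"
    then obtain j k where jk: "x = (j, k)" by (cases x)
    have "j \<noteq> 0" "k \<noteq> 0" using x jk botR[of j k] by auto
    then obtain j' k' where jk': "j = Suc j'" "k = Suc k'" by (cases j; cases k) auto
    show "(case x of (j, k) \<Rightarrow> (j - 1, k - 1)) \<in> ?S - {(n - 1, n - 1)}"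
      using x by (auto simp: jk jk' e_def algebra_simps)
    show "(case case x of (j, k) \<Rightarrow> (j - 1, k - 1) of (j, k) \<Rightarrow> (Suc j, Suc k)) = x"
      by (simp add: jk jk')
  qed
  moreover have "e (n - 1) (n - 1) div int n = 1" "(e 0 0 - 1) div int n = 0"
    using n by (simp_all add: e_def of_nat_diff algebra_simps)
  ultimately show ?thesis
    using sum.remove[OF fin(1) S1, of "\<lambda>(j, k). F (e j k div int n)"]
      sum.remove[OF fin(2) R0, of "\<lambda>(j, k). F ((e j k - 1) div int n)"]
    by simp
qed

section \<open>Splitting the exponents into quotients and residues\<close>

text \<open>Turns the index \<open>i\<close>, counted from 0, into the residue of the multiplier
  \<open>i + 1\<close>, with \<open>n\<close> represented by 0.\<close>

definition cyc_perm :: "nat \<Rightarrow> nat \<Rightarrow> nat" where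
  "cyc_perm n i = (if i < n then (i + 1) mod n else i)"

lemma cyc_perm_permutes: "cyc_perm n permutes {0..<n}"
proof (rule bij_imp_permutes)
  have "inj_on (cyc_perm n) {0..<n}"
  proof (rule inj_onI)
    fix i j assume ij: "i \<in> {0..<n}" "j \<in> {0..<n}" "cyc_perm n i = cyc_perm n j"
    hence "[i + 1 = j + 1] (mod n)" by (simp add: cyc_perm_def cong_def)
    hence "[i = j] (mod n)" by (simp only: cong_add_rcancel_nat)
    thus "i = j" using ij cong_less_modulus_unique_nat[of i j n] by simp
  qed
  moreover have "cyc_perm n ` {0..<n} \<subseteq> {0..<n}"
    by (auto simp: cyc_perm_def)
  ultimately show "bij_betw (cyc_perm n) {0..<n} {0..<n}"
    by (simp add: bij_betw_def endo_inj_surj)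
qed (simp add: cyc_perm_def)

lemma int_mult_perm_cyc_perm:
  assumes "i < n"
  shows "int ((mult_perm a n \<circ> cyc_perm n) i) = a * (int i + 1) mod int n"
proof -
  have "int (cyc_perm n i) = (int i + 1) mod int n"
    using assms by (simp add: cyc_perm_def zmod_int add.commute)
  moreover have "cyc_perm n i < n" using assms by (simp add: cyc_perm_def)
  ultimately show ?thesis by (simp only: o_apply int_mult_perm mod_mult_right_eq)
qed

lemma mult_perm_comp: "mult_perm a n \<circ> mult_perm b n = mult_perm (a * b) n"
proof
  fix i
  show "(mult_perm a n \<circ> mult_perm b n) i = mult_perm (a * b) n i"
  proof (cases "i < n")
    case True
    have "int (mult_perm a n (mult_perm b n i)) = int (mult_perm (a * b) n i)"
      using True by (simp only: int_mult_perm mult_perm_less mod_mult_right_eq mult.assoc)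
    thus ?thesis by (simp only: o_apply of_nat_eq_iff)
  qed (simp add: mult_perm_def)
qed

text \<open>The cyclic shift enters both permutations, so its sign is squared away.\<close>

lemma sign_mult_perm_cyc_perm:
  assumes n: "odd n" and a: "coprime a (int n)" and b: "coprime b (int n)"
  shows "sign (mult_perm a n \<circ> cyc_perm n) * sign (mult_perm b n \<circ> cyc_perm n) = Jacobi (a * b) n"
proof -
  have perm: "permutation (mult_perm a n)" "permutation (mult_perm b n)" "permutation (cyc_perm n)"
    using mult_perm_permutes[OF a] mult_perm_permutes[OF b] cyc_perm_permutes[of n]
    by (auto simp: permutation_permutes)
  have "sign (mult_perm a n \<circ> cyc_perm n) * sign (mult_perm b n \<circ> cyc_perm n)
      = sign (mult_perm a n) * sign (mult_perm b n) * (sign (cyc_perm n) * sign (cyc_perm n))"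
    by (simp only: sign_compose[OF perm(1,3)] sign_compose[OF perm(2,3)] mult_ac)
  also have "\<dots> = sign (mult_perm a n) * sign (mult_perm b n)" by simp
  also have "\<dots> = sign (mult_perm (a * b) n)"
    by (simp only: sign_compose[OF perm(1,2), symmetric] mult_perm_comp)
  also have "\<dots> = Jacobi (a * b) n"
    using n a b by (intro sign_mult_perm_eq_Jacobi) simp_all
  finally show ?thesis .
qed

lemma prod_power_int:
  fixes q :: "'a::field"
  assumes "q \<noteq> 0"
  shows "(\<Prod>i\<in>S. q powi f i) = q powi (\<Sum>i\<in>S. f i)"
  using assms by (induction S rule: infinite_finite_induct) (simp_all add: power_int_add)

lemma residues_eq:
  assumes "i < n" "j < n" "int n dvd int i - int j"
  shows "i = j"
proof -
  have "[i = j] (mod n)" using assms(3) by (simp add: cong_int_iff[symmetric] cong_iff_dvd_diff)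
  thus ?thesis using assms cong_less_modulus_unique_nat[of i j n] by simp
qed

text \<open>\<open>A\<close>, \<open>B\<close> are the quotients and \<open>\<sigma>\<close>,
  \<open>\<tau>\<close> the residues of the row and column multiples. The inverses \<open>J\<close>
  and \<open>K\<close> find the row and the column with a given residue.\<close>

locale split_residues =
  fixes n :: nat and a :: int and \<sigma> \<tau> :: "nat \<Rightarrow> nat" and A B :: "nat \<Rightarrow> int"
  assumes n: "n > 0" and a: "coprime a (int n)" and b: "coprime (a + 1) (int n)"
    and \<sigma>: "\<sigma> permutes {0..<n}" and \<tau>: "\<tau> permutes {0..<n}"
    and A: "\<And>j. j < n \<Longrightarrow> a * (int j + 1) = int n * A j + int (\<sigma> j)"
    and B: "\<And>k. k < n \<Longrightarrow> (a + 1) * (int k + 1) = int n * B k + int (\<tau> k)"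
begin

definition "J = inv_into UNIV \<sigma>"
definition "K = inv_into UNIV \<tau>"

lemma J: "r < n \<Longrightarrow> J r < n" "\<sigma> (J r) = r" "J (\<sigma> j) = j" "j < n \<Longrightarrow> \<sigma> j < n"
  using permutes_in_image[OF permutes_inv[OF \<sigma>], of r] permutes_in_image[OF \<sigma>, of j]
    permutes_inverses[OF \<sigma>]
  by (simp_all add: J_def)

lemma K: "r < n \<Longrightarrow> K r < n" "\<tau> (K r) = r" "K (\<tau> j) = j" "j < n \<Longrightarrow> \<tau> j < n"
  using permutes_in_image[OF permutes_inv[OF \<tau>], of r] permutes_in_image[OF \<tau>, of j]
    permutes_inverses[OF \<tau>]
  by (simp_all add: K_def)

definition e :: "nat \<Rightarrow> nat \<Rightarrow> int" where
  "e j k = (a + 1) * (int k + 1) - a * (int j + 1)"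

lemma e_eq: "j < n \<Longrightarrow> k < n \<Longrightarrow> e j k = int n * (B k - A j) + (int (\<tau> k) - int (\<sigma> j))"
  using A[of j] B[of k] unfolding e_def by (simp only: right_diff_distrib)

definition pred :: "nat \<Rightarrow> nat" where
  "pred r = (if r = 0 then n - 1 else r - 1)"

lemma pred_less: "r < n \<Longrightarrow> pred r < n"
  by (auto simp: pred_def)

text \<open>\<open>e j k\<close> is divisible by \<open>n\<close> exactly when row \<open>j\<close>
  and column \<open>k\<close> have the same residue \<open>r\<close>, so \<open>r\<close>
  parametrizes these pairs.\<close>

lemma sum_same_residue:
  fixes F :: "int \<Rightarrow> 'b::ab_group_add"
  shows "(\<Sum>r<n. F (B (K r) - A (J r)))
     = (\<Sum>(j, k)\<in>{(j, k). j < n \<and> k < n \<and> int n dvd e j k}. F (e j k div int n))"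
proof (rule sum.reindex_bij_witness[where j = "\<lambda>r. (J r, K r)" and i = "\<lambda>(j, k). \<sigma> j"])
  fix r assume "r \<in> {..<n}"
  hence r: "r < n" by simp
  have e: "e (J r) (K r) = int n * (B (K r) - A (J r))"
    using r by (simp add: e_eq J K)
  show "(case (J r, K r) of (j, k) \<Rightarrow> \<sigma> j) = r" by (simp add: J)
  show "(J r, K r) \<in> {(j, k). j < n \<and> k < n \<and> int n dvd e j k}"
    using r by (simp add: J K e)
  show "(case (J r, K r) of (j, k) \<Rightarrow> F (e j k div int n)) = F (B (K r) - A (J r))"
    using n by (simp add: e)
next
  fix x assume "x \<in> {(j, k). j < n \<and> k < n \<and> int n dvd e j k}"
  then obtain j k where x: "x = (j, k)" "j < n" "k < n" "int n dvd e j k" by auto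
  hence "int n dvd int (\<tau> k) - int (\<sigma> j)"
    by (simp add: e_eq dvd_add_right_iff)
  hence "\<tau> k = \<sigma> j" using x by (intro residues_eq[of _ n]) (simp_all add: J K)
  hence "K (\<sigma> j) = k" using K(3)[of k] by simp
  thus "(J (case x of (j, k) \<Rightarrow> \<sigma> j), K (case x of (j, k) \<Rightarrow> \<sigma> j)) = x"
    by (simp add: x J)
  show "(case x of (j, k) \<Rightarrow> \<sigma> j) \<in> {..<n}" using x by (simp add: J)
qed

text \<open>Here the residue of the column is the cyclic successor of the residue of the
  row.\<close>

lemma sum_next_residue:
  fixes F :: "int \<Rightarrow> 'b::ab_group_add"
  shows "(\<Sum>r<n. F (B (K r) - A (J (pred r)) - (if r = 0 then 1 else 0)))
     = (\<Sum>(j, k)\<in>{(j, k). j < n \<and> k < n \<and> int n dvd e j k - 1}. F ((e j k - 1) div int n))"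
proof (rule sum.reindex_bij_witness[where j = "\<lambda>r. (J (pred r), K r)" and i = "\<lambda>(j, k). \<tau> k"])
  fix r assume "r \<in> {..<n}"
  hence r: "r < n" by simp
  have "e (J (pred r)) (K r) - 1 = int n * (B (K r) - A (J (pred r))) + (int r - int (pred r) - 1)"
    using r by (simp add: e_eq J K pred_less)
  \<comment> \<open>At \<open>r = 0\<close> the predecessor is \<open>n - 1\<close>, and
    \<open>0 - (n - 1) - 1 = -n\<close> lowers the quotient by 1.\<close>
  also have "int r - int (pred r) - 1 = int n * (- (if r = 0 then 1 else 0))"
    using n by (auto simp: pred_def of_nat_diff)
  finally have e: "e (J (pred r)) (K r) - 1 = int n * (B (K r) - A (J (pred r)) - (if r = 0 then 1 else 0))"
    by (simp add: algebra_simps)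
  show "(case (J (pred r), K r) of (j, k) \<Rightarrow> \<tau> k) = r" by (simp add: K)
  show "(J (pred r), K r) \<in> {(j, k). j < n \<and> k < n \<and> int n dvd e j k - 1}"
    using r by (simp add: J K pred_less e)
  show "(case (J (pred r), K r) of (j, k) \<Rightarrow> F ((e j k - 1) div int n))
      = F (B (K r) - A (J (pred r)) - (if r = 0 then 1 else 0))"
    using n by (simp add: e)
next
  fix x assume "x \<in> {(j, k). j < n \<and> k < n \<and> int n dvd e j k - 1}"
  then obtain j k where x: "x = (j, k)" "j < n" "k < n" "int n dvd e j k - 1" by auto
  have "int n dvd int n * (B k - A j) + (int (\<tau> k) - int (\<sigma> j) - 1)"
    using x by (simp add: e_eq algebra_simps)
  hence *: "int n dvd int (\<tau> k) - int (\<sigma> j) - 1"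
    by (simp only: dvd_add_right_iff dvd_triv_left)
  have "int n dvd int (pred (\<tau> k)) - int (\<sigma> j)"
  proof (cases "\<tau> k = 0")
    case True
    have "int (pred (\<tau> k)) - int (\<sigma> j) = int n + (int (\<tau> k) - int (\<sigma> j) - 1)"
      using True n by (simp add: pred_def of_nat_diff)
    thus ?thesis using * by (simp only: dvd_add_right_iff dvd_refl)
  next
    case False
    have "int (pred (\<tau> k)) - int (\<sigma> j) = int (\<tau> k) - int (\<sigma> j) - 1"
      using False by (simp add: pred_def of_nat_diff)
    thus ?thesis using * by (simp only:)
  qed
  hence "pred (\<tau> k) = \<sigma> j" using x by (intro residues_eq[of _ n]) (simp_all add: J K pred_less)
  thus "(J (pred (case x of (j, k) \<Rightarrow> \<tau> k)), K (case x of (j, k) \<Rightarrow> \<tau> k)) = x"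
    by (simp add: x J K)
  show "(case x of (j, k) \<Rightarrow> \<tau> k) \<in> {..<n}" using x by (simp add: K)
qed

text \<open>The twist \<open>inverse q\<close> at \<open>r = 0\<close> is precisely the exponent
  correction for the wrap-around in \<open>sum_next_residue\<close>, so the residue sums apply with
  \<open>F i = q powi i\<close>.\<close>

lemma sum_twisted_diff:
  fixes q :: "'b::field"
  assumes q: "q \<noteq> 0"
  shows "(\<Sum>r<n. twisted_diff n (inverse q) (\<lambda>r. x * q powi (- A (J r))) r * q powi (B (K r)))
       = x * (q - 1)"
proof -
  have "twisted_diff n (inverse q) (\<lambda>r. x * q powi (- A (J r))) r * q powi (B (K r))
      = x * (q powi (B (K r) - A (J r))
          - q powi (B (K r) - A (J (pred r)) - (if r = 0 then 1 else 0)))" for r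
    using q by (simp add: twisted_diff_def pred_def power_int_diff power_int_minus power_int_add field_simps)
  hence "(\<Sum>r<n. twisted_diff n (inverse q) (\<lambda>r. x * q powi (- A (J r))) r * q powi (B (K r)))
      = x * ((\<Sum>r<n. q powi (B (K r) - A (J r)))
           - (\<Sum>r<n. q powi (B (K r) - A (J (pred r)) - (if r = 0 then 1 else 0))))"
    by (simp only: sum_distrib_left[symmetric] sum_subtractf)
  also have "(\<Sum>r<n. q powi (B (K r) - A (J r)))
           - (\<Sum>r<n. q powi (B (K r) - A (J (pred r)) - (if r = 0 then 1 else 0)))
           = q powi 1 - q powi 0"
    unfolding sum_same_residue[of "\<lambda>i. q powi i"] sum_next_residue[of "\<lambda>i. q powi i"] e_def
    by (rule sum_over_residue_classes[OF n a b])
  finally show ?thesis by simp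
qed

text \<open>Sum the difference of the two division identities over all indices: the residues cancel,
  as both permutations have the same sum, and \<open>-n (n + 1) / 2 = -n (m + 1)\<close>
  remains.\<close>

lemma sum_quotients:
  assumes "n = 2 * m + 1"
  shows "(\<Sum>j<n. A j) + (\<Sum>k<n. - B k) = - int (m + 1)"
proof -
  have "(\<Sum>j<n. int (\<sigma> j)) = (\<Sum>j<n. int j)" "(\<Sum>j<n. int (\<tau> j)) = (\<Sum>j<n. int j)"
    using sum.permute[OF \<sigma>, of int] sum.permute[OF \<tau>, of int] by (simp_all add: lessThan_atLeast0)
  moreover have "(\<Sum>j<n. (int n * A j + int (\<sigma> j)) - (int n * B j + int (\<tau> j)))
      = (\<Sum>j<n. - (int j + 1))"
  proof (rule sum.cong)
    fix j assume "j \<in> {..<n}"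
    hence "a * (int j + 1) = int n * A j + int (\<sigma> j)"
      "(a + 1) * (int j + 1) = int n * B j + int (\<tau> j)" by (simp_all only: A B lessThan_iff)
    thus "(int n * A j + int (\<sigma> j)) - (int n * B j + int (\<tau> j)) = - (int j + 1)"
      by (simp add: algebra_simps)
  qed simp
  moreover have "(\<Sum>j<n. (int n * A j + int (\<sigma> j)) - (int n * B j + int (\<tau> j)))
      = int n * ((\<Sum>j<n. A j) + (\<Sum>k<n. - B k)) + ((\<Sum>j<n. int (\<sigma> j)) - (\<Sum>j<n. int (\<tau> j)))"
    by (simp only: sum.distrib sum_subtractf sum_distrib_left[symmetric] sum_negf) (simp add: algebra_simps)
  ultimately have "int n * ((\<Sum>j<n. A j) + (\<Sum>k<n. - B k)) = (\<Sum>j<n. - (int j + 1))"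
    by (simp only:)
  moreover have "2 * (\<Sum>j<i. - (int j + 1)) = - (int i * (int i + 1))" for i
    by (induction i) (simp_all add: algebra_simps)
  hence "2 * (\<Sum>j<n. - (int j + 1)) = - (int n * (int n + 1))" .
  moreover have "int n + 1 = 2 * int (m + 1)" by (simp add: assms)
  ultimately have "int n * ((\<Sum>j<n. A j) + (\<Sum>k<n. - B k)) = int n * (- int (m + 1))"
    by (simp only:)
  thus ?thesis using n by (simp only: mult_cancel_left of_nat_eq_0_iff) simp
qed

end

section \<open>Evaluation of the two determinants\<close>

lemma one_minus_inverse_power_even:
  fixes q :: "'a::field"
  assumes q: "q \<noteq> 0"
  shows "(1 - inverse q) ^ (2 * m) = (1 - q) ^ (2 * m) * q powi (- int (2 * m))"
proof -
  have "(1 - inverse q) ^ (2 * m) = ((1 - q) * (- inverse q)) ^ (2 * m)"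
    using q by (simp add: algebra_simps)
  also have "\<dots> = (1 - q) ^ (2 * m) * inverse q ^ (2 * m)"
    unfolding power_mult_distrib by simp
  also have "inverse q ^ (2 * m) = q powi (- int (2 * m))"
    by (simp only: power_int_minus power_int_of_nat power_inverse)
  finally show ?thesis .
qed

lemma det_floor_matrix_coprime:
  fixes x q :: "'a::field"
  assumes n: "odd n" and q: "q \<noteq> 0" "q \<noteq> 1"
    and a: "coprime a (int n)" and b: "coprime (a + 1) (int n)"
  shows "det (mat n n (\<lambda>(j, k). x + q powi ((a * (int j + 1) - (a + 1) * (int k + 1)) div int n)))
       = of_int (Jacobi (a * (a + 1)) n) * q powi ((1 - 3 * int n) div 2)
         * (1 - q) ^ (n - 1) * (1 + q * x)"
proof -
  obtain m where m: "n = 2 * m + 1" using n by (auto elim: oddE)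
  have n0: "n > 0" using m by simp
  define \<sigma> where "\<sigma> = mult_perm a n \<circ> cyc_perm n"
  define \<tau> where "\<tau> = mult_perm (a + 1) n \<circ> cyc_perm n"
  define A where "A j = a * (int j + 1) div int n" for j
  define B where "B k = (a + 1) * (int k + 1) div int n" for k
  have \<sigma>_mod: "a * (int j + 1) mod int n = int (\<sigma> j)" if "j < n" for j
    unfolding \<sigma>_def int_mult_perm_cyc_perm[OF that] ..
  have \<tau>_mod: "(a + 1) * (int k + 1) mod int n = int (\<tau> k)" if "k < n" for k
    unfolding \<tau>_def int_mult_perm_cyc_perm[OF that] ..
  interpret split_residues n a \<sigma> \<tau> A B
  proof
    show "n > 0" "coprime a (int n)" "coprime (a + 1) (int n)" by fact+
    show "\<sigma> permutes {0..<n}" "\<tau> permutes {0..<n}"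
      unfolding \<sigma>_def \<tau>_def
      by (intro permutes_compose cyc_perm_permutes mult_perm_permutes a b)+
    show "a * (int j + 1) = int n * A j + int (\<sigma> j)" if "j < n" for j
      unfolding A_def \<sigma>_mod[OF that, symmetric] by (rule mult_div_mod_eq[symmetric])
    show "(a + 1) * (int k + 1) = int n * B k + int (\<tau> k)" if "k < n" for k
      unfolding B_def \<tau>_mod[OF that, symmetric] by (rule mult_div_mod_eq[symmetric])
  qed
  define H where "H r s = (if s \<le> r then 1 else inverse q)
      + x * q powi (- A (J r)) * q powi (B (K s))" for r s
  \<comment> \<open>Taking \<open>q powi (A j - B k)\<close> out of the entry leaves a step matrix
    in the residues; the constant \<open>x\<close> turns into a rank one term.\<close>
  have entry: "x + q powi ((a * (int j + 1) - (a + 1) * (int k + 1)) div int n)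
      = q powi A j * q powi (- B k) * H (\<sigma> j) (\<tau> k)" if "j < n" "k < n" for j k
  proof -
    have "(a * (int j + 1) - (a + 1) * (int k + 1)) div int n
        = A j - B k - (if \<tau> k \<le> \<sigma> j then 0 else 1)"
      using n0 that by (simp only: int_div_diff A_def[symmetric] B_def[symmetric] \<sigma>_mod \<tau>_mod
          of_nat_0_less_iff of_nat_le_iff)
    moreover have "x + q powi (A j - B k - (if \<tau> k \<le> \<sigma> j then 0 else 1))
        = q powi A j * q powi (- B k) * H (\<sigma> j) (\<tau> k)"
      using q by (simp add: H_def J K power_int_diff power_int_minus power_int_add field_simps)
    ultimately show ?thesis by (simp only:)
  qed
  have "det (mat n n (\<lambda>(j, k). x + q powi ((a * (int j + 1) - (a + 1) * (int k + 1)) div int n)))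
      = det (mat n n (\<lambda>(j, k). q powi A j * q powi (- B k) * H (\<sigma> j) (\<tau> k)))"
    by (intro arg_cong[where f = det] eq_matI) (simp_all add: entry)
  also have "\<dots> = (\<Prod>j<n. q powi A j) * (\<Prod>k<n. q powi (- B k))
      * det (mat n n (\<lambda>(j, k). H (\<sigma> j) (\<tau> k)))"
    by (rule det_scale_rows_cols)
  also have "(\<Prod>j<n. q powi A j) * (\<Prod>k<n. q powi (- B k)) = q powi (- int (m + 1))"
    unfolding prod_power_int[OF q(1)] sum_quotients[OF m, symmetric]
    using q by (simp add: power_int_add)
  also have "det (mat n n (\<lambda>(j, k). H (\<sigma> j) (\<tau> k)))
      = of_int (sign \<sigma> * sign \<tau>) * det (mat n n (\<lambda>(j, k). H j k))"
    by (rule det_permute_rows_cols[OF \<sigma> \<tau>])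
  also have "sign \<sigma> * sign \<tau> = Jacobi (a * (a + 1)) n"
    unfolding \<sigma>_def \<tau>_def by (rule sign_mult_perm_cyc_perm[OF assms(1) a b])
  also have "det (mat n n (\<lambda>(j, k). H j k))
      = (1 - inverse q) ^ (n - 1) * (1 + x * (q - 1) / (1 - inverse q))"
    unfolding H_def sum_twisted_diff[OF q(1), symmetric]
    using q by (intro det_step_matrix_plus_rank_one n0) auto
  also have "x * (q - 1) / (1 - inverse q) = q * x"
    using q by (simp add: field_simps)
  also have "q powi (- int (m + 1)) * (of_int (Jacobi (a * (a + 1)) n)
        * ((1 - inverse q) ^ (n - 1) * (1 + q * x)))
      = of_int (Jacobi (a * (a + 1)) n) * (q powi (- int (m + 1)) * (1 - inverse q) ^ (n - 1))
        * (1 + q * x)"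
    by (simp only: mult_ac)
  also have "q powi (- int (m + 1)) * (1 - inverse q) ^ (n - 1)
      = q powi (- int (m + 1) + - int (2 * m)) * (1 - q) ^ (n - 1)"
    using q one_minus_inverse_power_even[OF q(1), of m]
    by (simp only: power_int_add m add_diff_cancel_right' simp_thms mult_ac)
  \<comment> \<open>The scaling contributes \<open>-(m + 1)\<close> and the even power of
    \<open>1 - inverse q\<close> contributes \<open>-2 m\<close>.\<close>
  also have "- int (m + 1) + - int (2 * m) = (1 - 3 * int n) div 2"
    by (simp add: m)
  finally show ?thesis by (simp only: mult.assoc)
qed

text \<open>For \<open>d = gcd (a + 1) n\<close> and \<open>m = n / d\<close>, moving
  \<open>m\<close> columns to the right changes the numerator by a multiple of \<open>n\<close>, so
  the power of \<open>q\<close> is multiplied by a constant \<open>y\<close>.\<close>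

lemma det_floor_matrix_not_coprime:
  fixes x q :: "'a::field"
  assumes n: "odd n" and q: "q \<noteq> 0" and b: "\<not> coprime (a + 1) (int n)"
  shows "det (mat n n (\<lambda>(j, k). x + q powi ((a * (int j + 1) - (a + 1) * (int k + 1)) div int n))) = 0"
    (is "det ?M = 0")
proof -
  define d where "d = nat (gcd (a + 1) (int n))"
  have n0: "n > 0" using n by (auto intro: Nat.gr0I)
  have d_int: "int d = gcd (a + 1) (int n)" by (simp add: d_def)
  have "int d dvd int n" unfolding d_int by simp
  hence "d dvd n" by (simp only: int_dvd_int_iff)
  then obtain m where m: "n = d * m" by blast
  have "d \<noteq> 1" using b d_int by (auto simp: coprime_iff_gcd_eq_1)
  moreover have "odd d" using n m by simp
  \<comment> \<open>With \<open>d \<ge> 3\<close> the three columns 0, \<open>m\<close> and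
    \<open>2 * m\<close> all exist.\<close>
  ultimately have d3: "d \<ge> 3" by (cases d rule: nat.exhaust; cases "d = 2") auto
  have m0: "m > 0" using n0 m by (auto intro: Nat.gr0I)
  have "3 * m \<le> d * m" using d3 by (rule mult_right_mono) simp
  hence lt: "0 < n" "m < n" "2 * m < n" using m m0 by auto
  have "int d dvd a + 1" unfolding d_int by simp
  then obtain c where c: "a + 1 = int d * c" by blast
  define y where "y = q powi (- c)"
  have shift: "(a * (int j + 1) - (a + 1) * (int (k + m) + 1)) div int n
      = (a * (int j + 1) - (a + 1) * (int k + 1)) div int n - c" for j k
  proof -
    have "a * (int j + 1) - (a + 1) * (int (k + m) + 1)
        = (a * (int j + 1) - (a + 1) * (int k + 1)) - (a + 1) * int m"
      by (simp add: algebra_simps)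
    also have "(a + 1) * int m = c * int n" by (simp add: c m)
    finally have "a * (int j + 1) - (a + 1) * (int (k + m) + 1)
        = (a * (int j + 1) - (a + 1) * (int k + 1)) + (- c) * int n" by simp
    thus ?thesis using n0 by (simp only: div_mult_self1 of_nat_eq_0_iff)
  qed
  define w where "w j k = q powi ((a * (int j + 1) - (a + 1) * (int k + 1)) div int n)" for j k
  have w_shift: "w j (k + m) = w j k * y" for j k
    unfolding w_def shift y_def using q by (simp add: power_int_diff power_int_minus field_simps)
  have w1: "w j m = w j 0 * y" and w2: "w j (2 * m) = w j 0 * y * y" for j
    using w_shift[of j 0] w_shift[of j m] by (simp_all add: mult_2)
  \<comment> \<open>Columns \<open>0\<close>, \<open>m\<close>, \<open>2m\<close> are \<open>x + w\<close>, \<open>x + w y\<close>, \<open>x + w y\<^sup>2\<close>, all in the span of two vectors.\<close>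
  define v where "v = vec n (\<lambda>k. (if k = 0 then y else 0) + (if k = m then - (1 + y) else 0)
      + (if k = 2 * m then 1 else 0))"
  have "v $ 0 = y" using lt m0 by (simp add: v_def)
  hence "v \<noteq> 0\<^sub>v n" using lt q by (auto simp: y_def)
  moreover have "?M *\<^sub>v v = 0\<^sub>v n"
  proof (rule eq_vecI)
    fix j assume "j < dim_vec (0\<^sub>v n :: 'a vec)"
    hence j: "j < n" by simp
    have "(?M *\<^sub>v v) $ j = (\<Sum>k = 0..<n. (x + w j k) * ((if k = 0 then y else 0)
        + (if k = m then - (1 + y) else 0) + (if k = 2 * m then 1 else 0)))"
      using j by (simp add: scalar_prod_def v_def w_def)
    also have "\<dots> = (\<Sum>k = 0..<n. if k = 0 then (x + w j k) * y else 0)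
        + (\<Sum>k = 0..<n. if k = m then (x + w j k) * - (1 + y) else 0)
        + (\<Sum>k = 0..<n. if k = 2 * m then x + w j k else 0)"
      unfolding sum.distrib[symmetric] by (rule sum.cong) (auto simp: algebra_simps)
    also have "\<dots> = (x + w j 0) * y + (x + w j m) * - (1 + y) + (x + w j (2 * m))"
      using lt by (simp add: sum.delta)
    \<comment> \<open>The coefficients are those of (T - 1)(T - y): the root 1 kills the constant
      part \<open>x\<close>, the root \<open>y\<close> the geometric part \<open>w\<close>.\<close>
    also have "\<dots> = 0" unfolding w1 w2 by (simp add: algebra_simps)
    finally show "(?M *\<^sub>v v) $ j = 0\<^sub>v n $ j" using j by simp
  qed simp
  moreover have "v \<in> carrier_vec n" by (simp add: v_def)
  ultimately show ?thesis
    by (subst det_0_iff_vec_prod_zero[where n = n]) auto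
qed

lemma det_floor_matrix_transpose:
  fixes x q :: "'a::field"
  shows "det (mat n n (\<lambda>(j, k). x + q powi ((a * (int k + 1) - (a + 1) * (int j + 1)) div int n)))
       = det (mat n n (\<lambda>(j, k). x + q powi ((a * (int j + 1) - (a + 1) * (int k + 1)) div int n)))"
proof -
  have "mat n n (\<lambda>(j, k). x + q powi ((a * (int k + 1) - (a + 1) * (int j + 1)) div int n))
      = transpose_mat (mat n n (\<lambda>(j, k). x + q powi ((a * (int j + 1) - (a + 1) * (int k + 1)) div int n)))"
    by (rule eq_matI) simp_all
  thus ?thesis by (simp add: det_transpose[where n = n])
qed

lemma det_floor_matrix:
  fixes x q :: "'a::field"
  assumes n: "odd n" and q: "q \<noteq> 0"
  shows "det (mat n n (\<lambda>(j, k). x + q powi ((a * (int j + 1) - (a + 1) * (int k + 1)) div int n)))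
       = of_int (Jacobi (a * (a + 1)) n) * q powi ((1 - 3 * int n) div 2)
         * (1 - q) ^ (n - 1) * (1 + q * x)" (is "det ?M = _")
proof -
  have n0: "n > 0" using n by (auto intro: Nat.gr0I)
  consider "\<not> coprime a (int n)" | "\<not> coprime (a + 1) (int n)"
    | "coprime a (int n)" "coprime (a + 1) (int n)" "q \<noteq> 1"
    | "q = 1" "n = 1" | "q = 1" "n \<noteq> 1" by blast
  thus ?thesis
  proof cases
    case 1
    \<comment> \<open>The substitution of \<open>-a - 1\<close> for \<open>a\<close> turns
      \<open>a + 1\<close> into \<open>-a\<close> and transposes the matrix, reducing this case to
      the other common factor.\<close>
    have "det (mat n n (\<lambda>(j, k). x + q powi
        (((- a - 1) * (int j + 1) - ((- a - 1) + 1) * (int k + 1)) div int n))) = 0"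
      using 1 by (intro det_floor_matrix_not_coprime n q) simp
    moreover have "(- a - 1) * (int j + 1) - ((- a - 1) + 1) * (int k + 1)
        = a * (int k + 1) - (a + 1) * (int j + 1)" for j k
      by (simp add: algebra_simps)
    ultimately have "det ?M = 0" by (simp only: det_floor_matrix_transpose)
    moreover have "Jacobi (a * (a + 1)) n = 0" using 1 n0 by (intro Jacobi_eq_0) simp_all
    ultimately show ?thesis by simp
  next
    case 2
    moreover have "Jacobi (a * (a + 1)) n = 0" using 2 n0 by (intro Jacobi_eq_0) simp_all
    ultimately show ?thesis using det_floor_matrix_not_coprime[OF n q] by simp
  next
    case 3
    thus ?thesis by (intro det_floor_matrix_coprime n q)
  next
    case 4
    \<comment> \<open>Here \<open>(1 - q) ^ (n - 1)\<close> is \<open>0 ^ 0 = 1\<close>, and both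
      sides are \<open>1 + x\<close>.\<close>
    thus ?thesis by (simp add: det_single Jacobi_def)
  next
    case 5
    hence "1 < n" using n0 by simp
    hence "det ?M = 0"
      by (intro det_identical_rows[of ?M n 0 1]) (auto simp: 5)
    moreover have "(1 - q) ^ (n - 1) = 0" using 5 \<open>1 < n\<close> by simp
    ultimately show ?thesis by simp
  qed
qed

lemma det_ceiling_matrix:
  fixes x q :: "'a::field"
  assumes n: "odd n" and q: "q \<noteq> 0"
  shows "det (mat n n (\<lambda>(j, k). x + q powi (- ((a * (int k + 1) - (a + 1) * (int j + 1)) div int n))))
       = of_int (Jacobi (a * (a + 1)) n) * q powi ((int n - 1) div 2)
         * (1 - q) ^ (n - 1) * (x + q)"
proof -
  obtain m where m: "n = 2 * m + 1" using n by (auto elim: oddE)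
  have "det (mat n n (\<lambda>(j, k). x + q powi (- ((a * (int k + 1) - (a + 1) * (int j + 1)) div int n))))
      = det (mat n n (\<lambda>(j, k). x + inverse q powi ((a * (int k + 1) - (a + 1) * (int j + 1)) div int n)))"
    by (simp add: power_int_minus power_int_inverse)
  also have "\<dots> = of_int (Jacobi (a * (a + 1)) n) * (inverse q powi ((1 - 3 * int n) div 2)
         * (1 - inverse q) ^ (n - 1)) * (1 + inverse q * x)"
    using q by (simp only: det_floor_matrix_transpose det_floor_matrix[OF n, of "inverse q"]
        inverse_nonzero_iff_nonzero not_False_eq_True mult.assoc)
  also have "inverse q powi ((1 - 3 * int n) div 2) = q powi (int (3 * m + 1))"
  proof -
    have "(1 - 3 * int n) div 2 = - int (3 * m + 1)" by (simp add: m)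
    thus ?thesis by (simp only: power_int_inverse power_int_minus inverse_inverse_eq)
  qed
  also have "(1 - inverse q) ^ (n - 1) = (1 - q) ^ (n - 1) * q powi (- int (2 * m))"
    using one_minus_inverse_power_even[OF q, of m] by (simp only: m add_diff_cancel_right')
  also have "q powi (int (3 * m + 1)) * ((1 - q) ^ (n - 1) * q powi (- int (2 * m)))
      = q powi (int (3 * m + 1) + - int (2 * m)) * (1 - q) ^ (n - 1)"
    using q by (simp only: power_int_add simp_thms mult_ac)
  \<comment> \<open>The exponent is one more than the desired (n - 1)/2; the spare \<open>q\<close>
    turns \<open>1 + inverse q * x\<close> into \<open>x + q\<close>.\<close>
  also have "int (3 * m + 1) + - int (2 * m) = (int n - 1) div 2 + 1"
    by (simp add: m)
  also have "q powi ((int n - 1) div 2 + 1) = q powi ((int n - 1) div 2) * q"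
    using q by (simp add: power_int_add)
  also have "of_int (Jacobi (a * (a + 1)) n) * (q powi ((int n - 1) div 2) * q * (1 - q) ^ (n - 1))
        * (1 + inverse q * x)
      = of_int (Jacobi (a * (a + 1)) n) * q powi ((int n - 1) div 2) * (1 - q) ^ (n - 1)
        * (q * (1 + inverse q * x))"
    by (simp only: mult_ac)
  also have "q * (1 + inverse q * x) = x + q"
    using q by (simp add: field_simps)
  finally show ?thesis .
qed

theorem theorem1p3:
  fixes a :: int and n :: nat and x q :: complex
  assumes "n > 0" and "odd n" and "q \<noteq> 0"
  shows "(det (mat n n (\<lambda>(j, k). x + q powi
            \<lfloor>(of_int (a * int (j+1) - (a+1) * int (k+1)) :: real) / real n\<rfloor>))
         = of_int (Jacobi (a * (a+1)) n) * q powi ((1 - 3 * int n) div 2)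
           * (1 - q) ^ (n - 1) * (1 + q * x)) \<and>
         (det (mat n n (\<lambda>(j, k). x + q powi
            \<lceil>(of_int ((a+1) * int (j+1) - a * int (k+1)) :: real) / real n\<rceil>))
         = of_int (Jacobi (a * (a+1)) n) * q powi ((int n - 1) div 2)
           * (1 - q) ^ (n - 1) * (x + q))"
proof -
  have floor: "\<lfloor>(of_int i :: real) / real n\<rfloor> = i div int n" for i
    using floor_divide_of_int_eq[of i "int n", where ?'a = real] by simp
  \<comment> \<open>A ceiling is the negative of the floor of the negated quotient; negating the
    numerator gives the transposed floor exponents.\<close>
  have ceiling: "\<lceil>(of_int i :: real) / real n\<rceil> = - ((- i) div int n)" for i
    using ceiling_divide_eq_div[of i "int n", where ?'a = real] by simp
  have Suc: "int (i + 1) = int i + 1" for i by simp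
  have "- ((a + 1) * (int j + 1) - a * (int k + 1)) = a * (int k + 1) - (a + 1) * (int j + 1)"
    for j k by simp
  thus ?thesis
    unfolding floor ceiling Suc
    using det_floor_matrix[OF assms(2,3), of x a] det_ceiling_matrix[OF assms(2,3), of x a]
    by (simp only: simp_thms)
qed

end
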